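(* Let $\Gamma$ be a connected strongly regular graph with vertex set $X$. Then $\Gamma$ is pseudo-vertex-transitive if and only if for every pair of vertices $x,y\in X$, the local graph $\Delta_1(x)$ and the local graph $\Delta_1(y)$ have the same spectrum (the same multiset of adjacency eigenvalues).
   Context: A strongly regular graph with parameters $(n,k,a,c)$ is a $k$-regular graph on $n$ vertices in which every pair of adjacent vertices has exactly $a$ common neighbours and every pair of distinct non-adjacent vertices has exactly $c$ common neighbours. Let $\Gamma$ have vertex set $X$, path-length distance $\partial$ and diameter $D$. For $x\in X$ and $0\le i\le D$ let $\Delta_i(x)$ be the subgraph induced on $\{y\in X:\partial(x,y)=i\}$; $\Delta_1(x)$ is the local graph at $x$. Let $V=\mathbb{C}^X$, $A$ the adjacency matrix, and $E^*_i(x)$ the diagonal matrix with $(E^*_i(x))_{yy}=1$ if $\partial(x,y)=i$ and $0$ otherwise. The Terwilliger algebra $T(x)$ is the subalgebra of $\mathrm{Mat}_X(\mathbb{C})$ generated by $A,E^*_0(x),\dots,E^*_D(x)$. The graph $\Gamma$ is pseudo-vertex-transitive if for all $x,y\in X$: (i) there is a $\mathbb{C}$-algebra isomorphism $T(x)\to T(y)$ sending $A\mapsto A$ and $E^*_i(x)\mapsto E^*_i(y)$ for all $0\le i\le D$; and (ii) there is a $\mathbb{C}$-linear bijection $\rho:V\to V$ with $\rho A=A\rho$ and $\rho E^*_i(x)=E^*_i(y)\rho$ for all $0\le i\le D$. *)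

theory Defs
  imports "Jordan_Normal_Form.Matrix" "Jordan_Normal_Form.Char_Poly"
    "HOL-Computational_Algebra.Fundamental_Theorem_Algebra"
begin

text \<open>A finite simple graph on the vertex set X = {0..<n}, given by an adjacency
  predicate E (only its values on X matter).\<close>

definition simple_graph :: "nat \<Rightarrow> (nat \<Rightarrow> nat \<Rightarrow> bool) \<Rightarrow> bool" where
  "simple_graph n E \<longleftrightarrow> (\<forall>x<n. \<forall>y<n. E x y \<longrightarrow> E y x) \<and> (\<forall>x<n. \<not> E x x)"

definition edge_rel :: "nat \<Rightarrow> (nat \<Rightarrow> nat \<Rightarrow> bool) \<Rightarrow> (nat \<times> nat) set" where
  "edge_rel n E = {(u, v). u < n \<and> v < n \<and> E u v}"

definition connected_graph :: "nat \<Rightarrow> (nat \<Rightarrow> nat \<Rightarrow> bool) \<Rightarrow> bool" where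
  "connected_graph n E \<longleftrightarrow> (\<forall>x<n. \<forall>y<n. (x, y) \<in> (edge_rel n E)\<^sup>*)"

definition common_nbrs :: "nat \<Rightarrow> (nat \<Rightarrow> nat \<Rightarrow> bool) \<Rightarrow> nat \<Rightarrow> nat \<Rightarrow> nat" where
  "common_nbrs n E x y = card {z. z < n \<and> E x z \<and> E y z}"

definition strongly_regular :: "nat \<Rightarrow> (nat \<Rightarrow> nat \<Rightarrow> bool) \<Rightarrow> nat \<Rightarrow> nat \<Rightarrow> nat \<Rightarrow> bool" where
  "strongly_regular n E k a c \<longleftrightarrow> simple_graph n E \<and>
     (\<forall>x<n. card {y. y < n \<and> E x y} = k) \<and>
     (\<forall>x<n. \<forall>y<n. E x y \<longrightarrow> common_nbrs n E x y = a) \<and>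
     (\<forall>x<n. \<forall>y<n. x \<noteq> y \<and> \<not> E x y \<longrightarrow> common_nbrs n E x y = c)"

text \<open>Path-length distance and diameter.\<close>

definition gdist :: "nat \<Rightarrow> (nat \<Rightarrow> nat \<Rightarrow> bool) \<Rightarrow> nat \<Rightarrow> nat \<Rightarrow> nat" where
  "gdist n E x y = (LEAST k. (x, y) \<in> edge_rel n E ^^ k)"

definition diameter :: "nat \<Rightarrow> (nat \<Rightarrow> nat \<Rightarrow> bool) \<Rightarrow> nat" where
  "diameter n E = Max {gdist n E x y | x y. x < n \<and> y < n}"

text \<open>Adjacency matrix A and dual idempotents E*_i(x).\<close>

definition adj_mat :: "nat \<Rightarrow> (nat \<Rightarrow> nat \<Rightarrow> bool) \<Rightarrow> complex mat" where
  "adj_mat n E = mat n n (\<lambda>(y, z). if E y z then 1 else 0)"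

definition dual_idem :: "nat \<Rightarrow> (nat \<Rightarrow> nat \<Rightarrow> bool) \<Rightarrow> nat \<Rightarrow> nat \<Rightarrow> complex mat" where
  "dual_idem n E x i = mat n n (\<lambda>(y, z). if y = z \<and> gdist n E x y = i then 1 else 0)"

text \<open>Subalgebra of Mat_X(C) generated by a set of matrices.\<close>

inductive_set gen_alg :: "complex mat set \<Rightarrow> complex mat set" for G where
  gen: "g \<in> G \<Longrightarrow> g \<in> gen_alg G"
| add: "a \<in> gen_alg G \<Longrightarrow> b \<in> gen_alg G \<Longrightarrow> a + b \<in> gen_alg G"
| mult: "a \<in> gen_alg G \<Longrightarrow> b \<in> gen_alg G \<Longrightarrow> a * b \<in> gen_alg G"
| smult: "a \<in> gen_alg G \<Longrightarrow> r \<cdot>\<^sub>m a \<in> gen_alg G"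

definition terwilliger :: "nat \<Rightarrow> (nat \<Rightarrow> nat \<Rightarrow> bool) \<Rightarrow> nat \<Rightarrow> complex mat set" where
  "terwilliger n E x =
     gen_alg (insert (adj_mat n E) {dual_idem n E x i | i. i \<le> diameter n E})"

text \<open>C-algebra isomorphism between two algebras of matrices.\<close>

definition alg_iso :: "complex mat set \<Rightarrow> complex mat set \<Rightarrow> (complex mat \<Rightarrow> complex mat) \<Rightarrow> bool" where
  "alg_iso S T f \<longleftrightarrow> bij_betw f S T \<and>
     (\<forall>a\<in>S. \<forall>b\<in>S. f (a + b) = f a + f b \<and> f (a * b) = f a * f b) \<and>
     (\<forall>r. \<forall>a\<in>S. f (r \<cdot>\<^sub>m a) = r \<cdot>\<^sub>m f a)"

definition pseudo_vertex_transitive :: "nat \<Rightarrow> (nat \<Rightarrow> nat \<Rightarrow> bool) \<Rightarrow> bool" where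
  "pseudo_vertex_transitive n E \<longleftrightarrow>
     (\<forall>x<n. \<forall>y<n.
        (\<exists>f. alg_iso (terwilliger n E x) (terwilliger n E y) f \<and>
             f (adj_mat n E) = adj_mat n E \<and>
             (\<forall>i\<le>diameter n E. f (dual_idem n E x i) = dual_idem n E y i)) \<and>
        (\<exists>P \<in> carrier_mat n n. invertible_mat P \<and>
             P * adj_mat n E = adj_mat n E * P \<and>
             (\<forall>i\<le>diameter n E. P * dual_idem n E x i = dual_idem n E y i * P)))"

text \<open>Local graph Delta_1(x): the subgraph induced on the neighbours of x;
  its adjacency matrix (w.r.t. the increasing enumeration of the neighbours)
  and its spectrum = multiset of eigenvalues (roots of the characteristic
  polynomial, with algebraic multiplicity).\<close>

definition nbr_list :: "nat \<Rightarrow> (nat \<Rightarrow> nat \<Rightarrow> bool) \<Rightarrow> nat \<Rightarrow> nat list" where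
  "nbr_list n E x = sorted_list_of_set {y. y < n \<and> E x y}"

definition local_adj_mat :: "nat \<Rightarrow> (nat \<Rightarrow> nat \<Rightarrow> bool) \<Rightarrow> nat \<Rightarrow> complex mat" where
  "local_adj_mat n E x =
     (let vs = nbr_list n E x
      in mat (length vs) (length vs) (\<lambda>(i, j). if E (vs ! i) (vs ! j) then 1 else 0))"

definition spectrum_mat :: "complex mat \<Rightarrow> complex multiset" where
  "spectrum_mat M = proots (char_poly M)"

end

theory Submission
  imports Defs "Jordan_Normal_Form.Schur_Decomposition"
begin

text \<open>A unitary \<open>U\<close> that commutes with \<open>A\<close> and maps each \<open>E*_i(x)\<close> to \<open>E*_i(y)\<close> gives both
  parts of pseudo-vertex-transitivity, the algebra isomorphism being conjugation by \<open>U\<close>.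
  If the local spectra agree, choose a unitary \<open>W\<close> with \<open>W L_x = L_y W\<close> and \<open>W 1 = 1\<close>, where
  \<open>L_z\<close> is the adjacency matrix of the local graph at \<open>z\<close>. Since \<open>A\<^sup>2\<close> is a combination of
  \<open>A\<close>, \<open>I\<close> and \<open>J\<close>, the components in the three eigenspaces of \<open>A\<close> of the vector \<open>e_x\<close> and of
  the vectors \<open>e_w\<close> with \<open>w\<close> adjacent to \<open>x\<close> have the same Gram matrix as those of their images
  under \<open>1 + W\<close> at \<open>y\<close>. Families of eigenvectors of a hermitian matrix with equal Gram
  matrices are related by a unitary in its commutant, a product of Householder reflections in
  eigenvectors; this is \<open>U\<close>. It respects distances 0 and 1, hence also distance 2. Conversely,
  compressing the given bijection \<open>P\<close> to the neighbours of \<open>x\<close> and \<open>y\<close> makes the local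
  adjacency matrices similar.\<close>

section \<open>Matrix products, inner products and adjoints\<close>

lemma mult_assoc_dim:
  fixes A B C :: "'a::semiring_0 mat"
  assumes "dim_col A = dim_row B" "dim_col B = dim_row C"
  shows "(A * B) * C = A * (B * C)"
  using assms by (intro assoc_mult_mat[of _ "dim_row A" "dim_col A" _ "dim_col B" _ "dim_col C"]) auto

lemma mult_vec_assoc_dim:
  fixes A B :: "'a::semiring_0 mat"
  assumes "dim_col A = dim_row B" "dim_col B = dim_vec v"
  shows "A *\<^sub>v (B *\<^sub>v v) = (A * B) *\<^sub>v v"
  using assms
  by (intro assoc_mult_mat_vec[of _ "dim_row A" "dim_col A" _ "dim_col B", symmetric])
     (auto intro: carrier_vecI)

lemma mult_mat_vec_sum:
  "i < dim_row A \<Longrightarrow> (A *\<^sub>v v) $ i = (\<Sum>j<dim_vec v. A $$ (i, j) * v $ j)"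
  if "dim_col A = dim_vec v"
  using that by (auto simp: scalar_prod_def atLeast0LessThan intro!: sum.cong)

lemma mult_mat_sum:
  "i < dim_row A \<Longrightarrow> j < dim_col B \<Longrightarrow> (A * B) $$ (i, j) = (\<Sum>k<dim_row B. A $$ (i, k) * B $$ (k, j))"
  if "dim_col A = dim_row B"
  using that by (auto simp: scalar_prod_def atLeast0LessThan intro!: sum.cong)

lemma cscalar_prod_sum: "(u::complex vec) \<bullet>c v = (\<Sum>i<dim_vec v. u $ i * cnj (v $ i))"
  by (auto simp: scalar_prod_def atLeast0LessThan intro!: sum.cong)

lemma cscalar_prod_commute: "dim_vec u = dim_vec v \<Longrightarrow> (u::complex vec) \<bullet>c v = cnj (v \<bullet>c u)"
  by (simp add: cscalar_prod_sum mult.commute)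

lemma cscalar_prod_minus_left:
  "dim_vec u = dim_vec w \<Longrightarrow> dim_vec v = dim_vec w \<Longrightarrow> ((u::complex vec) - v) \<bullet>c w = u \<bullet>c w - v \<bullet>c w"
  by (simp add: cscalar_prod_sum sum_subtractf algebra_simps)

lemma cscalar_prod_smult_left:
  "dim_vec u = dim_vec w \<Longrightarrow> (a \<cdot>\<^sub>v (u::complex vec)) \<bullet>c w = a * (u \<bullet>c w)"
  by (simp add: cscalar_prod_sum sum_distrib_left algebra_simps)

lemma cscalar_prod_smult_right:
  "dim_vec u = dim_vec w \<Longrightarrow> (u::complex vec) \<bullet>c (a \<cdot>\<^sub>v w) = cnj a * (u \<bullet>c w)"
  by (simp add: cscalar_prod_sum sum_distrib_left algebra_simps)

lemma conjugate_unit_vec: "conjugate (unit_vec n i :: complex vec) = unit_vec n i"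
  by (rule eq_vecI) (auto simp: unit_vec_def)

lemma mat_eq_unit_vecI:
  fixes A B :: "'a::semiring_1 mat"
  assumes "A \<in> carrier_mat n m" "B \<in> carrier_mat n m"
    and "\<And>i. i < m \<Longrightarrow> A *\<^sub>v unit_vec m i = B *\<^sub>v unit_vec m i"
  shows "A = B"
proof (rule eq_matI)
  fix i j assume ij: "i < dim_row B" "j < dim_col B"
  have "(A *\<^sub>v unit_vec m j) $ i = (B *\<^sub>v unit_vec m j) $ i" using assms ij by simp
  thus "A $$ (i, j) = B $$ (i, j)" using assms(1,2) ij by simp
qed (use assms in auto)

lemma mat_adjoint_dim [simp]:
  "dim_row (mat_adjoint A) = dim_col A" "dim_col (mat_adjoint A) = dim_row A"
  by (simp_all add: mat_adjoint_def)

lemma mat_adjoint_carrier [simp]: "A \<in> carrier_mat n m \<Longrightarrow> mat_adjoint A \<in> carrier_mat m n"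
  by (auto intro: carrier_matI)

lemma mat_adjoint_index [simp]:
  "i < dim_col A \<Longrightarrow> j < dim_row A \<Longrightarrow> mat_adjoint A $$ (i, j) = conjugate (A $$ (j, i))"
  by (simp add: mat_adjoint_def mat_of_rows_def)

lemma mat_adjoint_adjoint [simp]: "mat_adjoint (mat_adjoint A) = A"
  by (rule eq_matI) auto

lemma mat_adjoint_one [simp]: "mat_adjoint (1\<^sub>m n :: complex mat) = 1\<^sub>m n"
  by (rule eq_matI) auto

lemma mat_adjoint_mult:
  fixes A B :: "complex mat"
  assumes "dim_col A = dim_row B"
  shows "mat_adjoint (A * B) = mat_adjoint B * mat_adjoint A"
  using assms by (intro eq_matI) (auto simp: scalar_prod_def mult.commute intro!: sum.cong)

lemma cscalar_prod_adjoint: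
  fixes A :: "complex mat"
  assumes "dim_col A = dim_vec u" "dim_row A = dim_vec v"
  shows "(A *\<^sub>v u) \<bullet>c v = u \<bullet>c (mat_adjoint A *\<^sub>v v)"
proof -
  have "(A *\<^sub>v u) \<bullet>c v = (\<Sum>i<dim_vec v. \<Sum>j<dim_vec u. A $$ (i, j) * u $ j * cnj (v $ i))"
    using assms by (simp add: cscalar_prod_sum mult_mat_vec_sum sum_distrib_right del: index_mult_mat_vec)
  also have "\<dots> = (\<Sum>j<dim_vec u. \<Sum>i<dim_vec v. A $$ (i, j) * u $ j * cnj (v $ i))"
    by (rule sum.swap)
  also have "\<dots> = u \<bullet>c (mat_adjoint A *\<^sub>v v)"
    using assms by (simp add: cscalar_prod_sum mult_mat_vec_sum sum_distrib_left mult_ac del: index_mult_mat_vec)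
  finally show ?thesis .
qed

section \<open>Unitary matrices\<close>

definition unitary_mat :: "nat \<Rightarrow> complex mat \<Rightarrow> bool" where
  "unitary_mat n U \<longleftrightarrow> U \<in> carrier_mat n n \<and> mat_adjoint U * U = 1\<^sub>m n"

lemma unitary_matD:
  assumes "unitary_mat n U"
  shows "U \<in> carrier_mat n n" "dim_row U = n" "dim_col U = n"
    "mat_adjoint U * U = 1\<^sub>m n" "U * mat_adjoint U = 1\<^sub>m n"
  using assms mat_mult_left_right_inverse[of "mat_adjoint U" n U]
  by (auto simp: unitary_mat_def)

lemma unitary_mat_one: "unitary_mat n (1\<^sub>m n)"
  by (simp add: unitary_mat_def)

lemma unitary_mat_adjoint:
  assumes "unitary_mat n U"
  shows "unitary_mat n (mat_adjoint U)"
  using unitary_matD(1,5)[OF assms] by (auto simp: unitary_mat_def)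

lemma unitary_mat_mult:
  assumes "unitary_mat n U" "unitary_mat n V"
  shows "unitary_mat n (U * V)"
proof -
  note D = unitary_matD[OF assms(1)] unitary_matD[OF assms(2)]
  have "mat_adjoint (U * V) * (U * V) = mat_adjoint V * ((mat_adjoint U * U) * V)"
    using D(2,3,7,8) by (simp add: mat_adjoint_mult mult_assoc_dim)
  also have "\<dots> = 1\<^sub>m n" using D by simp
  finally show ?thesis using D by (simp add: unitary_mat_def)
qed

lemma unitary_mat_cscalar_prod:
  assumes "unitary_mat n U" "u \<in> carrier_vec n" "v \<in> carrier_vec n"
  shows "(U *\<^sub>v u) \<bullet>c (U *\<^sub>v v) = u \<bullet>c v"
proof -
  note D = unitary_matD[OF assms(1)]
  have "(U *\<^sub>v u) \<bullet>c (U *\<^sub>v v) = u \<bullet>c (mat_adjoint U *\<^sub>v (U *\<^sub>v v))"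
    using D assms by (intro cscalar_prod_adjoint) auto
  also have "mat_adjoint U *\<^sub>v (U *\<^sub>v v) = (mat_adjoint U * U) *\<^sub>v v"
    using D assms by (intro mult_vec_assoc_dim) auto
  finally show ?thesis using D assms by simp
qed

text \<open>For an isometry \<open>X\<close> the matrix \<open>X * mat_adjoint X\<close> is the
  projection onto its range. The dual idempotents at distances 0 and 1 will be written in this
  shape.\<close>

lemma unitary_intertwines_projections:
  assumes U: "unitary_mat n U" and X: "X \<in> carrier_mat n m" and eq: "U * X = Z"
  shows "U * (X * mat_adjoint X) = (Z * mat_adjoint Z) * U"
proof -
  note D = unitary_matD[OF U]
  have "(Z * mat_adjoint Z) * U = U * (X * (mat_adjoint X * (mat_adjoint U * U)))"
    using D(2,3) X unfolding eq[symmetric] by (simp add: mat_adjoint_mult mult_assoc_dim)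
  also have "\<dots> = U * (X * mat_adjoint X)" using D X by simp
  finally show ?thesis by simp
qed

section \<open>Householder reflections\<close>

lemma hermitian_eigenvalue_real:
  fixes A :: "complex mat"
  assumes "A \<in> carrier_mat n n" "mat_adjoint A = A"
    and "w \<in> carrier_vec n" "w \<noteq> 0\<^sub>v n" "A *\<^sub>v w = e \<cdot>\<^sub>v w"
  shows "cnj e = e"
proof -
  have "e * (w \<bullet>c w) = (A *\<^sub>v w) \<bullet>c w" using assms by (simp add: cscalar_prod_smult_left)
  also have "\<dots> = w \<bullet>c (A *\<^sub>v w)" using cscalar_prod_adjoint[of A w w] assms by auto
  also have "\<dots> = cnj e * (w \<bullet>c w)" using assms by (simp add: cscalar_prod_smult_right)
  finally show ?thesis using assms(3,4) conjugate_square_eq_0_vec[of w n] by auto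
qed

text \<open>Over the reals this is the reflection in the hyperplane orthogonal to \<open>u - v\<close>; the
  denominator \<open>u \<bullet>c (u - v)\<close> is the one that works when \<open>u \<bullet>c v\<close> is not real.\<close>

lemma householder:
  assumes u: "u \<in> carrier_vec n" and v: "v \<in> carrier_vec n" and uv: "u \<bullet>c u = v \<bullet>c v"
  obtains H where "unitary_mat n H" "H *\<^sub>v u = v"
    "\<And>z. z \<in> carrier_vec n \<Longrightarrow> z \<bullet>c u = z \<bullet>c v \<Longrightarrow> H *\<^sub>v z = z"
    "\<And>A e. A \<in> carrier_mat n n \<Longrightarrow> mat_adjoint A = A \<Longrightarrow> A *\<^sub>v u = e \<cdot>\<^sub>v u \<Longrightarrow>
       A *\<^sub>v v = e \<cdot>\<^sub>v v \<Longrightarrow> H * A = A * H"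
proof (cases "u = v")
  case True
  show ?thesis
    by (rule that[of "1\<^sub>m n"]) (use u True in \<open>auto simp: unitary_mat_one\<close>)
next
  case False
  define w where "w = u - v"
  have w: "w \<in> carrier_vec n" using u v by (simp add: w_def)
  have dims: "dim_vec u = n" "dim_vec v = n" "dim_vec w = n" using u v w by auto
  have w0: "w \<noteq> 0\<^sub>v n"
  proof
    assume z: "w = 0\<^sub>v n"
    have "u $ i = v $ i" if "i < n" for i
      using arg_cong[OF z, of "\<lambda>x. x $ i"] that dims by (simp add: w_def)
    thus False using False dims by (auto intro: eq_vecI)
  qed
  have ww0: "w \<bullet>c w \<noteq> 0" using w0 w by simp
  define b where "b = u \<bullet>c w"
  have right: "z \<bullet>c w = z \<bullet>c u - z \<bullet>c v" if "dim_vec z = n" for z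
    using that dims by (simp add: w_def cscalar_prod_sum sum_subtractf algebra_simps)
  \<comment> \<open>Equal norms make the squared norm of \<open>w\<close> twice the real part of
    \<open>b\<close>. Hence \<open>b\<close> is nonzero, and the cross terms in H* H will cancel the
    quadratic one.\<close>
  have ww: "w \<bullet>c w = b + cnj b"
  proof -
    have "w \<bullet>c w = u \<bullet>c u - v \<bullet>c u - (u \<bullet>c v - v \<bullet>c v)"
      using dims right[of w] by (simp add: w_def cscalar_prod_minus_left)
    moreover have "b = u \<bullet>c u - u \<bullet>c v" using right[of u] dims by (simp add: b_def)
    moreover have "cnj b = u \<bullet>c u - v \<bullet>c u"
      unfolding calculation(2) using dims cscalar_prod_commute[of u v] cscalar_prod_commute[of u u] by simp
    ultimately show ?thesis using uv by simp
  qed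
  have b0: "b \<noteq> 0" using ww ww0 by auto
  \<comment> \<open>This is I - w w* / b: it subtracts exactly \<open>w\<close> from
    \<open>u\<close>, and fixes everything orthogonal to \<open>w\<close>.\<close>
  define H where "H = mat n n (\<lambda>(i, j). (if i = j then 1 else 0) - w $ i * cnj (w $ j) / b)"
  have H: "H \<in> carrier_mat n n" by (simp add: H_def)
  have Hz: "H *\<^sub>v z = z - ((z \<bullet>c w) / b) \<cdot>\<^sub>v w" if "z \<in> carrier_vec n" for z
  proof (rule eq_vecI)
    fix i assume "i < dim_vec (z - ((z \<bullet>c w) / b) \<cdot>\<^sub>v w)"
    hence i: "i < n" using dims by simp
    have "(H *\<^sub>v z) $ i = (\<Sum>j<n. ((if i = j then 1 else 0) - w $ i * cnj (w $ j) / b) * z $ j)"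
      using i that H by (simp add: mult_mat_vec_sum H_def del: index_mult_mat_vec)
    also have "\<dots> = (\<Sum>j<n. (if i = j then z $ j else 0)) - (\<Sum>j<n. z $ j * cnj (w $ j) / b * w $ i)"
      unfolding sum_subtractf[symmetric] by (intro sum.cong) (auto simp: algebra_simps)
    also have "\<dots> = z $ i - (z \<bullet>c w) / b * w $ i"
      using i dims by (simp add: cscalar_prod_sum sum_distrib_right sum_divide_distrib)
    finally show "(H *\<^sub>v z) $ i = (z - ((z \<bullet>c w) / b) \<cdot>\<^sub>v w) $ i" using i dims that by simp
  qed (use H dims that in auto)
  have partial_fraction: "(x + y) * (t / (x * y)) = t / y + t / x" if "x \<noteq> 0" "y \<noteq> 0" for x y t :: complex
    using that by (simp add: field_simps)
  have "mat_adjoint H * H = 1\<^sub>m n"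
  proof (rule eq_matI)
    fix i j assume ij: "i < dim_row (1\<^sub>m n :: complex mat)" "j < dim_col (1\<^sub>m n :: complex mat)"
    have "(mat_adjoint H * H) $$ (i, j) =
      (\<Sum>k<n. ((if k = i then 1 else 0) - cnj (w $ k) * w $ i / cnj b) * ((if k = j then 1 else 0) - w $ k * cnj (w $ j) / b))"
      using ij by (subst mult_mat_sum) (auto simp: H_def intro!: sum.cong)
    also have "\<dots> = (\<Sum>k<n. (if k = i then (if i = j then 1 else 0) else 0)
        - (if k = j then cnj (w $ j) * w $ i / cnj b else 0)
        - (if k = i then w $ i * cnj (w $ j) / b else 0)
        + w $ k * cnj (w $ k) * (w $ i * cnj (w $ j) / (b * cnj b)))"
      by (intro sum.cong) (auto simp: algebra_simps)
    also have "\<dots> = (if i = j then 1 else 0) - cnj (w $ j) * w $ i / cnj b - w $ i * cnj (w $ j) / b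
        + (w \<bullet>c w) * (w $ i * cnj (w $ j) / (b * cnj b))"
      using ij dims by (simp add: sum.distrib sum_subtractf cscalar_prod_sum sum_distrib_right sum_divide_distrib)
    also have "(w \<bullet>c w) * (w $ i * cnj (w $ j) / (b * cnj b)) = w $ i * cnj (w $ j) / cnj b + w $ i * cnj (w $ j) / b"
      unfolding ww by (rule partial_fraction) (use b0 in auto)
    also have "(if i = j then 1 else 0) - cnj (w $ j) * w $ i / cnj b - w $ i * cnj (w $ j) / b + \<dots> = (if i = j then 1 else 0)"
      by (simp add: mult.commute)
    finally show "(mat_adjoint H * H) $$ (i, j) = 1\<^sub>m n $$ (i, j)" using ij by simp
  qed (use H in auto)
  hence un: "unitary_mat n H" using H by (simp add: unitary_mat_def)
  have "H *\<^sub>v u = v" using Hz[OF u] b0 dims unfolding b_def[symmetric] by (intro eq_vecI) (simp_all add: w_def)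
  moreover have "H *\<^sub>v z = z" if "z \<in> carrier_vec n" "z \<bullet>c u = z \<bullet>c v" for z
    using Hz[OF that(1)] right[of z] that dims by (intro eq_vecI) simp_all
  moreover have "H * A = A * H"
    if A: "A \<in> carrier_mat n n" "mat_adjoint A = A" "A *\<^sub>v u = e \<cdot>\<^sub>v u" "A *\<^sub>v v = e \<cdot>\<^sub>v v" for A e
  proof -
    \<comment> \<open>As a difference of eigenvectors for \<open>e\<close>, \<open>w\<close> is one
      as well; since \<open>e\<close> is real, the rank-one matrix w w* commutes with
      \<open>A\<close>.\<close>
    have Aw: "A *\<^sub>v w = e \<cdot>\<^sub>v w"
    proof -
      have "A *\<^sub>v w = e \<cdot>\<^sub>v u - e \<cdot>\<^sub>v v"
        using A u v by (simp add: w_def mult_minus_distrib_mat_vec)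
      also have "\<dots> = e \<cdot>\<^sub>v w" using dims by (intro eq_vecI) (simp_all add: w_def algebra_simps)
      finally show ?thesis .
    qed
    have e: "cnj e = e" by (rule hermitian_eigenvalue_real[OF A(1,2) w w0 Aw])
    show ?thesis
    proof (rule mat_eq_unit_vecI)
      fix i assume "i < n"
      define z :: "complex vec" where "z = unit_vec n i"
      have z: "z \<in> carrier_vec n" by (simp add: z_def)
      have "(A *\<^sub>v z) \<bullet>c w = e * (z \<bullet>c w)"
        using cscalar_prod_adjoint[of A z w] A z w Aw e by (auto simp: cscalar_prod_smult_right)
      hence "H *\<^sub>v (A *\<^sub>v z) = A *\<^sub>v z - (e * (z \<bullet>c w) / b) \<cdot>\<^sub>v w"
        using Hz[of "A *\<^sub>v z"] A z by simp
      also have "\<dots> = A *\<^sub>v (H *\<^sub>v z)"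
      proof -
        have "A *\<^sub>v (H *\<^sub>v z) = A *\<^sub>v z - A *\<^sub>v (((z \<bullet>c w) / b) \<cdot>\<^sub>v w)"
          using A(1) z w by (simp add: Hz mult_minus_distrib_mat_vec)
        also have "A *\<^sub>v (((z \<bullet>c w) / b) \<cdot>\<^sub>v w) = ((z \<bullet>c w) / b) \<cdot>\<^sub>v (e \<cdot>\<^sub>v w)"
          using A(1) w by (simp add: mult_mat_vec Aw)
        finally show ?thesis by (simp add: smult_smult_assoc mult.commute)
      qed
      finally show "(H * A) *\<^sub>v unit_vec n i = (A * H) *\<^sub>v unit_vec n i"
        using A H z by (simp add: z_def)
    qed (use A H in auto)
  qed
  ultimately show ?thesis using that[OF un] by blast
qed

subsection \<open>Unitary similarity of hermitian matrices\<close>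

lemma unit_eigenvector_exists:
  fixes A :: "complex mat"
  assumes A: "A \<in> carrier_mat n n" and root: "poly (char_poly A) e = 0"
  obtains u where "u \<in> carrier_vec n" "u \<bullet>c u = 1" "A *\<^sub>v u = e \<cdot>\<^sub>v u"
proof -
  obtain w where "eigenvector A w e"
    using eigenvalue_root_char_poly[OF A] root by (auto simp: eigenvalue_def)
  hence w: "w \<in> carrier_vec n" "w \<noteq> 0\<^sub>v n" "A *\<^sub>v w = e \<cdot>\<^sub>v w"
    using A by (auto simp: eigenvector_def)
  define q where "q = (\<Sum>i<n. (cmod (w $ i))\<^sup>2)"
  have ww: "w \<bullet>c w = of_real q"
    using w(1) by (auto simp: cscalar_prod_sum q_def complex_norm_square[symmetric])
  have "q \<ge> 0" by (auto simp: q_def intro: sum_nonneg)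
  moreover have "q \<noteq> 0" using ww w conjugate_square_eq_0_vec[of w n] by auto
  ultimately have q: "q > 0" by simp
  define u where "u = of_real (1 / sqrt q) \<cdot>\<^sub>v w"
  have "u \<bullet>c u = of_real (1 / sqrt q) * (of_real (1 / sqrt q) * of_real q)"
    unfolding u_def using w(1) by (simp add: cscalar_prod_smult_left cscalar_prod_smult_right ww)
  also have "\<dots> = of_real (1 / sqrt q * (1 / sqrt q * q))" by (simp only: of_real_mult)
  also have "1 / sqrt q * (1 / sqrt q * q) = 1" using q by (simp add: field_simps)
  finally have "u \<bullet>c u = 1" by simp
  moreover have "A *\<^sub>v u = e \<cdot>\<^sub>v u"
    using A w by (simp add: u_def mult_mat_vec smult_smult_assoc mult.commute)
  moreover have "u \<in> carrier_vec n" using w by (simp add: u_def)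
  ultimately show ?thesis using that by blast
qed

section \<open>Deflation and the spectral theorem\<close>

definition one_plus_mat :: "complex \<Rightarrow> nat \<Rightarrow> complex mat \<Rightarrow> complex mat" where
  "one_plus_mat e m A = four_block_mat (mat 1 1 (\<lambda>_. e)) (0\<^sub>m 1 m) (0\<^sub>m m 1) A"

lemma one_plus_mat_mult:
  assumes "X \<in> carrier_mat m m" "Y \<in> carrier_mat m m"
  shows "one_plus_mat e m X * one_plus_mat f m Y = one_plus_mat (e * f) m (X * Y)"
proof -
  have "mat 1 1 (\<lambda>_. e) * mat 1 1 (\<lambda>_. f) = mat 1 1 (\<lambda>_. e * f)"
    by (rule eq_matI) (auto simp: scalar_prod_def)
  thus ?thesis
    using assms unfolding one_plus_mat_def by (subst mult_four_block_mat[of _ 1 1 _ m _ m _ _ 1 _ m]) auto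
qed

lemma one_plus_mat_adjoint:
  "A \<in> carrier_mat m m \<Longrightarrow> mat_adjoint (one_plus_mat e m A) = one_plus_mat (cnj e) m (mat_adjoint A)"
  by (intro eq_matI) (auto simp: one_plus_mat_def)

lemma one_plus_mat_carrier:
  "A \<in> carrier_mat m m \<Longrightarrow> one_plus_mat e m A \<in> carrier_mat (Suc m) (Suc m)"
  by (auto simp: one_plus_mat_def intro!: carrier_matI)

text \<open>One step of the spectral theorem. In an orthonormal basis starting with
  \<open>u\<close>, the first column of \<open>A\<close> is \<open>e\<close> times the first basis
  vector, and hermitian symmetry clears the first row too.\<close>

lemma hermitian_deflation:
  fixes A :: "complex mat"
  assumes A: "A \<in> carrier_mat (Suc m) (Suc m)" and herm: "mat_adjoint A = A"
    and u: "u \<in> carrier_vec (Suc m)" "u \<bullet>c u = 1" "A *\<^sub>v u = e \<cdot>\<^sub>v u"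
  obtains H A' where "unitary_mat (Suc m) H" "A' \<in> carrier_mat m m" "mat_adjoint A' = A'"
    "A = H * one_plus_mat e m A' * mat_adjoint H"
    "char_poly A = [:-e, 1:] * char_poly A'"
proof -
  define n where "n = Suc m"
  note A = A[folded n_def] and u = u[folded n_def]
  define d :: "complex vec" where "d = unit_vec n 0"
  have d: "d \<in> carrier_vec n" by (simp add: d_def)
  have "d \<bullet>c d = 1" by (simp add: d_def n_def)
  then obtain H where H: "unitary_mat n H" "H *\<^sub>v d = u"
    \<comment> \<open>Both vectors have norm one, so a single reflection has \<open>u\<close> as its
      first column.\<close>
    using householder[OF d u(1)] u(2) by metis
  note D = unitary_matD[OF H(1)]
  define B where "B = mat_adjoint H * (A * H)"
  have B: "B \<in> carrier_mat n n" using A D by (auto simp: B_def)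
  have "mat_adjoint B = B"
    using A D(2,3) herm by (simp add: B_def mat_adjoint_mult mult_assoc_dim)
  hence Bsym: "B $$ (i, j) = cnj (B $$ (j, i))" if "i < n" "j < n" for i j
    using mat_adjoint_index[of i B j] B that by auto
  have Bd: "B *\<^sub>v d = e \<cdot>\<^sub>v d"
  proof -
    have "B *\<^sub>v d = mat_adjoint H *\<^sub>v (A *\<^sub>v (H *\<^sub>v d))"
      using A D(2,3) d by (simp add: B_def mult_vec_assoc_dim mult_assoc_dim)
    also have "\<dots> = e \<cdot>\<^sub>v (mat_adjoint H *\<^sub>v (H *\<^sub>v d))"
      using D(1) u by (simp add: H(2) mult_mat_vec[of _ n n])
    also have "mat_adjoint H *\<^sub>v (H *\<^sub>v d) = d"
      using D d by (simp add: mult_vec_assoc_dim)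
    finally show ?thesis .
  qed
  have B0: "B $$ (i, 0) = (if i = 0 then e else 0)" if "i < n" for i
    using arg_cong[OF Bd, of "\<lambda>x. x $ i"] that B by (auto simp: d_def n_def)
  define A' where "A' = mat m m (\<lambda>(i, j). B $$ (Suc i, Suc j))"
  have A': "A' \<in> carrier_mat m m" by (simp add: A'_def)
  have "mat_adjoint A' = A'"
    by (intro eq_matI) (auto simp: A'_def n_def Bsym[symmetric])
  have Bblock: "B = one_plus_mat e m A'"
  proof (rule eq_matI)
    fix i j assume "i < dim_row (one_plus_mat e m A')" "j < dim_col (one_plus_mat e m A')"
    hence ij: "i < n" "j < n" by (auto simp: A'_def n_def one_plus_mat_def)
    show "B $$ (i, j) = one_plus_mat e m A' $$ (i, j)"
    proof (cases "i = 0 \<or> j = 0")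
      case True
      hence "B $$ (i, j) = (if i = j then e else 0)"
        using B0 Bsym[of i j] Bsym[of 0 0] ij by (auto split: if_splits)
      thus ?thesis using True ij by (auto simp: A'_def n_def one_plus_mat_def)
    next
      case False
      thus ?thesis using ij by (auto simp: A'_def n_def one_plus_mat_def)
    qed
  qed (use B in \<open>auto simp: A'_def n_def one_plus_mat_def\<close>)
  have "H * B * mat_adjoint H = (H * mat_adjoint H) * (A * (H * mat_adjoint H))"
    using A D(2,3) by (simp add: B_def mult_assoc_dim)
  hence AB: "A = H * B * mat_adjoint H" using A D by simp
  have "similar_mat A B"
    by (rule similar_matI[of _ _ H "mat_adjoint H" n]) (use A B D AB in auto)
  hence "char_poly A = char_poly B" by (rule char_poly_similar)
  also have "\<dots> = char_poly (mat 1 1 (\<lambda>_. e)) * char_poly A'"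
    unfolding Bblock one_plus_mat_def by (rule char_poly_four_block_zeros_col) (auto simp: A')
  also have "char_poly (mat 1 1 (\<lambda>_. e)) = [:-e, 1:]"
    by (simp add: char_poly_defs det_single)
  finally have "char_poly A = [:-e, 1:] * char_poly A'" .
  thus ?thesis
    using that H(1) A' \<open>mat_adjoint A' = A'\<close> AB unfolding Bblock n_def by blast
qed

text \<open>Induction on the dimension. The two matrices share an eigenvalue \<open>e\<close>;
  deflating both by it and cancelling \<open>[:-e, 1:]\<close> leaves smaller hermitian matrices
  with equal characteristic polynomials.\<close>

lemma hermitian_unitarily_similar:
  fixes A B :: "complex mat"
  assumes "A \<in> carrier_mat n n" "mat_adjoint A = A" "B \<in> carrier_mat n n" "mat_adjoint B = B"
    and "char_poly A = char_poly B"
  shows "\<exists>U. unitary_mat n U \<and> U * A = B * U"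
  using assms
proof (induction n arbitrary: A B)
  case 0
  thus ?case by (intro exI[of _ "1\<^sub>m 0"]) (auto simp: unitary_mat_one)
next
  case (Suc m)
  note A = Suc.prems(1) and B = Suc.prems(3)
  have "degree (char_poly A) \<noteq> 0" using degree_monic_char_poly[OF A] by simp
  then obtain e where e: "poly (char_poly A) e = 0"
    using fundamental_theorem_of_algebra[of "char_poly A"] constant_degree[of "char_poly A"] by auto
  obtain u where "u \<in> carrier_vec (Suc m)" "u \<bullet>c u = 1" "A *\<^sub>v u = e \<cdot>\<^sub>v u"
    using unit_eigenvector_exists[OF A e] .
  then obtain H A' where H: "unitary_mat (Suc m) H" "A' \<in> carrier_mat m m" "mat_adjoint A' = A'"
    "A = H * one_plus_mat e m A' * mat_adjoint H"
    "char_poly A = [:-e, 1:] * char_poly A'"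
    using hermitian_deflation[OF A Suc.prems(2)] by blast
  obtain v where "v \<in> carrier_vec (Suc m)" "v \<bullet>c v = 1" "B *\<^sub>v v = e \<cdot>\<^sub>v v"
    using unit_eigenvector_exists[OF B] e Suc.prems(5) by metis
  then obtain G B' where G: "unitary_mat (Suc m) G" "B' \<in> carrier_mat m m" "mat_adjoint B' = B'"
    "B = G * one_plus_mat e m B' * mat_adjoint G"
    "char_poly B = [:-e, 1:] * char_poly B'"
    using hermitian_deflation[OF B Suc.prems(4)] by blast
  have "char_poly A' = char_poly B'"
    using Suc.prems(5) H(5) G(5) by (metis mult_left_cancel one_neq_zero pCons_eq_0_iff)
  then obtain V where V: "unitary_mat m V" "V * A' = B' * V"
    using Suc.IH[OF H(2,3) G(2,3)] by blast
  note DV = unitary_matD[OF V(1)] and DH = unitary_matD[OF H(1)] and DG = unitary_matD[OF G(1)]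
  \<comment> \<open>The smaller intertwiner acts as 1 on the eigenvector that was split off.\<close>
  let ?W = "one_plus_mat 1 m V" and ?A = "one_plus_mat e m A'" and ?B = "one_plus_mat e m B'"
  have c: "?W \<in> carrier_mat (Suc m) (Suc m)" "?A \<in> carrier_mat (Suc m) (Suc m)" "?B \<in> carrier_mat (Suc m) (Suc m)"
    using one_plus_mat_carrier DV(1) H(2) G(2) by blast+
  have "mat_adjoint ?W * ?W = one_plus_mat 1 m (1\<^sub>m m)"
    using one_plus_mat_mult[of "mat_adjoint V" m V "cnj 1" 1] DV by (simp add: one_plus_mat_adjoint)
  also have "\<dots> = 1\<^sub>m (Suc m)" by (rule eq_matI) (auto simp: one_plus_mat_def)
  finally have W: "unitary_mat (Suc m) ?W" using c(1) by (simp add: unitary_mat_def)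
  have WA: "?W * ?A = ?B * ?W"
    using one_plus_mat_mult[of V m A' 1 e] one_plus_mat_mult[of B' m V e 1] DV(1) H(2) G(2) V(2) by simp
  define W where "W = ?W"
  define P where "P = ?A"
  define Q where "Q = ?B"
  \<comment> \<open>Enter the basis adapted to \<open>A\<close>, apply the block intertwiner, and
    leave through the basis adapted to \<open>B\<close>.\<close>
  define U where "U = G * (W * mat_adjoint H)"
  note defs = W_def[symmetric] P_def[symmetric] Q_def[symmetric]
  note c = c[unfolded defs] and WA = WA[unfolded defs]
  have "unitary_mat (Suc m) U"
    unfolding U_def using W G(1) H(1) by (auto simp: W_def intro!: unitary_mat_mult unitary_mat_adjoint)
  moreover have "U * A = G * (W * ((mat_adjoint H * H) * (P * mat_adjoint H)))"
    using c DH(2,3) DG(2,3) unfolding U_def H(4)[unfolded defs] by (simp add: mult_assoc_dim)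
  hence "U * A = G * ((W * P) * mat_adjoint H)"
    using c DH DG(2,3) by (simp add: mult_assoc_dim)
  moreover have "B * U = G * (Q * ((mat_adjoint G * G) * (W * mat_adjoint H)))"
    using c DH(2,3) DG(2,3) unfolding U_def G(4)[unfolded defs] by (simp add: mult_assoc_dim)
  hence "B * U = G * ((Q * W) * mat_adjoint H)"
    using c DG DH(2,3) by (simp add: mult_assoc_dim)
  ultimately show ?case using WA by auto
qed

text \<open>Any unitary intertwiner \<open>V\<close> moves \<open>u\<close> into the
  \<open>e\<close>-eigenspace of \<open>B\<close>; the reflection taking
  \<open>V *\<^sub>v u\<close> to \<open>v\<close> commutes with \<open>B\<close> and corrects
  \<open>V\<close>. For local graphs, \<open>u\<close> and \<open>v\<close> will be all-ones
  vectors.\<close>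

lemma hermitian_unitarily_similar_eigenvector:
  fixes A B :: "complex mat"
  assumes A: "A \<in> carrier_mat n n" "mat_adjoint A = A" and B: "B \<in> carrier_mat n n" "mat_adjoint B = B"
    and cp: "char_poly A = char_poly B"
    and u: "u \<in> carrier_vec n" "A *\<^sub>v u = e \<cdot>\<^sub>v u" and v: "v \<in> carrier_vec n" "B *\<^sub>v v = e \<cdot>\<^sub>v v"
    and uv: "u \<bullet>c u = v \<bullet>c v"
  obtains U where "unitary_mat n U" "U * A = B * U" "U *\<^sub>v u = v"
proof -
  obtain V where V: "unitary_mat n V" "V * A = B * V"
    using hermitian_unitarily_similar[OF A B cp] by blast
  note D = unitary_matD[OF V(1)]
  have BV: "B *\<^sub>v (V *\<^sub>v u) = e \<cdot>\<^sub>v (V *\<^sub>v u)"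
  proof -
    have "B *\<^sub>v (V *\<^sub>v u) = (V * A) *\<^sub>v u" using V(2) B(1) D(1) u(1) by simp
    also have "\<dots> = V *\<^sub>v (e \<cdot>\<^sub>v u)" using D(1) A(1) u by simp
    finally show ?thesis using D(1) u(1) by (simp add: mult_mat_vec)
  qed
  have "(V *\<^sub>v u) \<bullet>c (V *\<^sub>v u) = v \<bullet>c v"
    using unitary_mat_cscalar_prod[OF V(1) u(1) u(1)] uv by simp
  then obtain H where H: "unitary_mat n H" "H *\<^sub>v (V *\<^sub>v u) = v" "H * B = B * H"
    using householder[of "V *\<^sub>v u" n v] D(1) u v B BV by (metis mult_mat_vec_carrier)
  note DH = unitary_matD[OF H(1)]
  show ?thesis
  proof (rule that[of "H * V"])
    show "unitary_mat n (H * V)" using H V by (intro unitary_mat_mult)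
    have "H * V * A = H * (B * V)" using D DH A V(2) by (simp add: mult_assoc_dim)
    also have "\<dots> = (H * B) * V" using D DH B by (simp add: mult_assoc_dim)
    also have "\<dots> = B * (H * V)" using D DH B unfolding H(3) by (simp add: mult_assoc_dim)
    finally show "H * V * A = B * (H * V)" .
    show "H * V *\<^sub>v u = v" using H(2) D(1) DH(1) u(1) by simp
  qed
qed

subsection \<open>Unitaries in the commutant of a hermitian matrix\<close>

text \<open>A Witt-type extension within the commutant of \<open>A\<close>. Once the earlier vectors
  are matched, a reflection moves the image of the new one to its target; equality of the Gram
  matrices makes it fix the earlier targets.\<close>

lemma eigenvector_family_extension:
  fixes A :: "complex mat"
  assumes A: "A \<in> carrier_mat n n" "mat_adjoint A = A" and "finite I"
    and x: "\<And>i. i \<in> I \<Longrightarrow> x i \<in> carrier_vec n" "\<And>i. i \<in> I \<Longrightarrow> A *\<^sub>v x i = e i \<cdot>\<^sub>v x i"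
    and y: "\<And>i. i \<in> I \<Longrightarrow> y i \<in> carrier_vec n" "\<And>i. i \<in> I \<Longrightarrow> A *\<^sub>v y i = e i \<cdot>\<^sub>v y i"
    and gram: "\<And>i j. i \<in> I \<Longrightarrow> j \<in> I \<Longrightarrow> x i \<bullet>c x j = y i \<bullet>c y j"
  shows "\<exists>U. unitary_mat n U \<and> U * A = A * U \<and> (\<forall>i\<in>I. U *\<^sub>v x i = y i)"
  using \<open>finite I\<close> x y gram
proof (induction I rule: finite_induct)
  case empty
  show ?case using A by (intro exI[of _ "1\<^sub>m n"]) (auto simp: unitary_mat_one)
next
  case (insert k I)
  note x = insert.prems(1,2) and y = insert.prems(3,4) and gram = insert.prems(5)
  obtain U where U: "unitary_mat n U" "U * A = A * U" "\<And>i. i \<in> I \<Longrightarrow> U *\<^sub>v x i = y i"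
    using insert.IH[OF x y gram] by auto
  note D = unitary_matD[OF U(1)]
  have xk: "x k \<in> carrier_vec n" and yk: "y k \<in> carrier_vec n" using x y by auto
  have c: "U *\<^sub>v x k \<in> carrier_vec n" using D(1) xk by simp
  have AU: "A *\<^sub>v (U *\<^sub>v x k) = e k \<cdot>\<^sub>v (U *\<^sub>v x k)"
  proof -
    have "A *\<^sub>v (U *\<^sub>v x k) = (U * A) *\<^sub>v x k" using U(2) A(1) D(1) xk by simp
    also have "\<dots> = U *\<^sub>v (e k \<cdot>\<^sub>v x k)" using D(1) A(1) xk x(2)[of k] by simp
    finally show ?thesis using D(1) xk by (simp add: mult_mat_vec)
  qed
  have "(U *\<^sub>v x k) \<bullet>c (U *\<^sub>v x k) = y k \<bullet>c y k"
    using unitary_mat_cscalar_prod[OF U(1) xk xk] gram[of k k] by simp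
  then obtain H where H: "unitary_mat n H" "H *\<^sub>v (U *\<^sub>v x k) = y k"
    "\<And>z. z \<in> carrier_vec n \<Longrightarrow> z \<bullet>c (U *\<^sub>v x k) = z \<bullet>c y k \<Longrightarrow> H *\<^sub>v z = z"
    and HA: "H * A = A * H"
    using householder[OF c yk] A AU y(2)[of k] by (metis insertI1)
  note DH = unitary_matD[OF H(1)]
  have "H * U *\<^sub>v x i = y i" if i: "i \<in> insert k I" for i
  proof (cases "i = k")
    case True
    thus ?thesis using H(2) D(1) DH(1) xk by simp
  next
    case False
    hence i: "i \<in> I" using that by simp
    \<comment> \<open>As \<open>y i\<close> is the image of \<open>x i\<close>, unitarity turns the
      left side into \<open>x i \<bullet>c x k\<close>, which is given by the Gram
      hypothesis.\<close>
    have "y i \<bullet>c (U *\<^sub>v x k) = y i \<bullet>c y k"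
      using unitary_mat_cscalar_prod[OF U(1), of "x i" "x k"] x i gram[of i k] U(3)[OF i] by simp
    hence "H *\<^sub>v y i = y i" using H(3) y i by auto
    thus ?thesis using U(3)[OF i] D(1) DH(1) x i by simp
  qed
  moreover have "H * U * A = A * (H * U)"
  proof -
    have "H * U * A = H * (A * U)" using D DH A U(2) by (simp add: mult_assoc_dim)
    also have "\<dots> = (H * A) * U" using D DH A by (simp add: mult_assoc_dim)
    also have "\<dots> = A * (H * U)" using D DH A unfolding HA by (simp add: mult_assoc_dim)
    finally show ?thesis .
  qed
  ultimately show ?case using unitary_mat_mult[OF H(1) U(1)] by blast
qed

section \<open>Matrices with three eigenvalues\<close>

abbreviation ones_vec :: "nat \<Rightarrow> complex vec" where
  "ones_vec n \<equiv> vec n (\<lambda>_. 1)"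

lemma cscalar_prod_add_left:
  "dim_vec u = dim_vec w \<Longrightarrow> dim_vec v = dim_vec w \<Longrightarrow> ((u::complex vec) + v) \<bullet>c w = u \<bullet>c w + v \<bullet>c w"
  by (simp add: cscalar_prod_sum sum.distrib algebra_simps)

lemma cscalar_prod_add_right:
  "dim_vec u = dim_vec v \<Longrightarrow> dim_vec w = dim_vec v \<Longrightarrow> (u::complex vec) \<bullet>c (v + w) = u \<bullet>c v + u \<bullet>c w"
  by (simp add: cscalar_prod_sum sum.distrib algebra_simps)

text \<open>For suitable \<open>\<alpha>\<close>, \<open>\<beta>\<close>, \<open>\<gamma>\<close> this is the component of \<open>z\<close> in one of the three eigenspaces
  of \<open>A\<close>.\<close>

definition comb :: "complex mat \<Rightarrow> nat \<Rightarrow> complex \<Rightarrow> complex \<Rightarrow> complex \<Rightarrow> complex vec \<Rightarrow> complex vec" where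
  "comb A n \<alpha> \<beta> \<gamma> z = \<alpha> \<cdot>\<^sub>v z + (\<beta> \<cdot>\<^sub>v (A *\<^sub>v z) + (\<gamma> * (z \<bullet>c ones_vec n)) \<cdot>\<^sub>v ones_vec n)"

text \<open>With J the all-ones matrix, \<open>A_square\<close> says (A - rI)(A - sI) = cJ, applied
  to a vector. So orthogonally to the all-ones vector the only possible eigenvalues are
  \<open>r\<close> and \<open>s\<close>.\<close>

locale three_eigenvalues =
  fixes A :: "complex mat" and n :: nat and k r s c :: complex
  assumes A: "A \<in> carrier_mat n n" and herm: "mat_adjoint A = A"
    and n: "n > 0" and rs: "r \<noteq> s" and A_ones: "A *\<^sub>v ones_vec n = k \<cdot>\<^sub>v ones_vec n"
    and A_square: "z \<in> carrier_vec n \<Longrightarrow>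
      A *\<^sub>v (A *\<^sub>v z) = comb A n (- r * s) (r + s) c z"
begin

lemma comb_carrier: "z \<in> carrier_vec n \<Longrightarrow> comb A n \<alpha> \<beta> \<gamma> z \<in> carrier_vec n"
  using A by (simp add: comb_def)

lemma comb_index:
  "z \<in> carrier_vec n \<Longrightarrow> i < n \<Longrightarrow>
     comb A n \<alpha> \<beta> \<gamma> z $ i = \<alpha> * z $ i + (\<beta> * (A *\<^sub>v z) $ i + \<gamma> * (z \<bullet>c ones_vec n))"
  using A by (simp add: comb_def del: index_mult_mat_vec)

text \<open>The span of I, A and J is closed under multiplication by A, because A^2 lies in it and
  AJ = kJ.\<close>

lemma A_comb:
  assumes z: "z \<in> carrier_vec n"
  shows "A *\<^sub>v comb A n \<alpha> \<beta> \<gamma> z = comb A n (- \<beta> * r * s) (\<alpha> + \<beta> * (r + s)) (\<beta> * c + \<gamma> * k) z"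
proof -
  have "A *\<^sub>v comb A n \<alpha> \<beta> \<gamma> z = \<alpha> \<cdot>\<^sub>v (A *\<^sub>v z) + (\<beta> \<cdot>\<^sub>v (A *\<^sub>v (A *\<^sub>v z)) + (\<gamma> * (z \<bullet>c ones_vec n)) \<cdot>\<^sub>v (A *\<^sub>v ones_vec n))"
    using A z by (simp add: comb_def mult_add_distrib_mat_vec[of A n n] mult_mat_vec[of A n n])
  also have "\<dots> = comb A n (- \<beta> * r * s) (\<alpha> + \<beta> * (r + s)) (\<beta> * c + \<gamma> * k) z"
    unfolding A_square[OF z] A_ones using A z
    by (intro eq_vecI) (simp_all add: comb_def algebra_simps del: index_mult_mat_vec)
  finally show ?thesis .
qed

lemma ones_prod: "ones_vec n \<bullet>c ones_vec n = of_nat n"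
  by (simp add: cscalar_prod_sum)

text \<open>Compare entry 0 of A^2 applied to the all-ones vector, on which A acts as
  \<open>k\<close> and J as \<open>n\<close>.\<close>

lemma k_equation: "of_nat n * c = (k - r) * (k - s)"
proof -
  have "(A *\<^sub>v (A *\<^sub>v ones_vec n)) $ 0 = k * k"
    using A n by (simp add: A_ones mult_mat_vec[of A n n] del: index_mult_mat_vec)
  moreover have "(A *\<^sub>v (A *\<^sub>v ones_vec n)) $ 0 = - r * s + ((r + s) * k + c * of_nat n)"
    unfolding A_square[OF vec_carrier] comb_index[OF vec_carrier n]
    using n by (simp add: A_ones ones_prod del: index_mult_mat_vec)
  ultimately show ?thesis by (simp add: algebra_simps)
qed

lemma k_real: "cnj k = k"
proof (rule hermitian_eigenvalue_real[OF A herm _ _ A_ones])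
  show "ones_vec n \<noteq> 0\<^sub>v n"
  proof
    assume "ones_vec n = 0\<^sub>v n"
    hence "ones_vec n $ 0 = 0\<^sub>v n $ 0" by simp
    thus False using n by simp
  qed
qed simp

text \<open>Expanded, the product involves only \<open>x \<bullet>c x'\<close>, the product of A x
  with x', that of A x with A x', and coordinate sums. The third is reduced to the others by
  \<open>A_square\<close>, so the four hypotheses determine everything.\<close>

lemma comb_prod:
  assumes "x \<in> carrier_vec n" "x' \<in> carrier_vec n" "y \<in> carrier_vec n" "y' \<in> carrier_vec n"
    and 1: "x \<bullet>c x' = y \<bullet>c y'" and 2: "(A *\<^sub>v x) \<bullet>c x' = (A *\<^sub>v y) \<bullet>c y'"
    and 3: "x \<bullet>c ones_vec n = y \<bullet>c ones_vec n" and 4: "x' \<bullet>c ones_vec n = y' \<bullet>c ones_vec n"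
  shows "comb A n \<alpha> \<beta> \<gamma> x \<bullet>c comb A n \<alpha>' \<beta>' \<gamma>' x' = comb A n \<alpha> \<beta> \<gamma> y \<bullet>c comb A n \<alpha>' \<beta>' \<gamma>' y'"
proof -
  \<comment> \<open>\<open>S z\<close> is the coordinate sum of \<open>z\<close>, so J z is
    \<open>S z\<close> times the all-ones vector.\<close>
  define S where "S z = z \<bullet>c ones_vec n" for z
  have onesl: "ones_vec n \<bullet>c z = cnj (S z)" if "z \<in> carrier_vec n" for z
    using that cscalar_prod_commute[of "ones_vec n" z] by (auto simp: S_def)
  have adj: "u \<bullet>c (A *\<^sub>v v) = (A *\<^sub>v u) \<bullet>c v" if "u \<in> carrier_vec n" "v \<in> carrier_vec n" for u v
    using cscalar_prod_adjoint[of A u v] A herm that by auto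
  have SA: "S (A *\<^sub>v z) = k * S z" if "z \<in> carrier_vec n" for z
    using adj[OF that, of "ones_vec n"] that A_ones k_real
    by (auto simp: S_def cscalar_prod_smult_right)
  have AA: "(A *\<^sub>v u) \<bullet>c (A *\<^sub>v v) = - r * s * (u \<bullet>c v) + ((r + s) * ((A *\<^sub>v u) \<bullet>c v) + c * S u * cnj (S v))"
    if uv: "u \<in> carrier_vec n" "v \<in> carrier_vec n" for u v
  proof -
    have "(A *\<^sub>v u) \<bullet>c (A *\<^sub>v v) = (A *\<^sub>v (A *\<^sub>v u)) \<bullet>c v"
      using adj[of "A *\<^sub>v u" v] A uv by simp
    also have "\<dots> = - r * s * (u \<bullet>c v) + ((r + s) * ((A *\<^sub>v u) \<bullet>c v) + c * S u * cnj (S v))"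
      unfolding A_square[OF uv(1)] comb_def S_def[symmetric]
      using uv A onesl[OF uv(2)] by (auto simp: cscalar_prod_add_left cscalar_prod_smult_left)
    finally show ?thesis .
  qed
  have expand: "comb A n \<alpha> \<beta> \<gamma> u \<bullet>c comb A n \<alpha>' \<beta>' \<gamma>' v =
      \<alpha> * (cnj \<alpha>' * (u \<bullet>c v) + (cnj \<beta>' * ((A *\<^sub>v u) \<bullet>c v) + cnj (\<gamma>' * S v) * S u))
      + (\<beta> * (cnj \<alpha>' * ((A *\<^sub>v u) \<bullet>c v) + (cnj \<beta>' * ((A *\<^sub>v u) \<bullet>c (A *\<^sub>v v)) + cnj (\<gamma>' * S v) * (k * S u)))
      + \<gamma> * S u * (cnj \<alpha>' * cnj (S v) + (cnj \<beta>' * cnj (k * S v) + cnj (\<gamma>' * S v) * of_nat n)))"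
    if uv: "u \<in> carrier_vec n" "v \<in> carrier_vec n" for u v
  proof -
    have right: "w \<bullet>c comb A n \<alpha>' \<beta>' \<gamma>' v = cnj \<alpha>' * (w \<bullet>c v) + (cnj \<beta>' * (w \<bullet>c (A *\<^sub>v v)) + cnj (\<gamma>' * S v) * S w)"
      if "w \<in> carrier_vec n" for w
      unfolding comb_def S_def[symmetric]
      using that uv A by (auto simp: cscalar_prod_add_right cscalar_prod_smult_right S_def[symmetric])
    have c: "dim_vec (comb A n \<alpha>' \<beta>' \<gamma>' v) = n" using comb_carrier[OF uv(2)] by auto
    have "comb A n \<alpha> \<beta> \<gamma> u \<bullet>c w = \<alpha> * (u \<bullet>c w) + (\<beta> * ((A *\<^sub>v u) \<bullet>c w) + \<gamma> * S u * (ones_vec n \<bullet>c w))"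
      if "dim_vec w = n" for w
      unfolding comb_def S_def[symmetric]
      using that uv A by (auto simp: cscalar_prod_add_left cscalar_prod_smult_left)
    note this[OF c]
    moreover have Au: "A *\<^sub>v u \<in> carrier_vec n" and Av: "A *\<^sub>v v \<in> carrier_vec n" using A uv by auto
    moreover have "S (ones_vec n) = of_nat n" by (simp add: S_def ones_prod)
    ultimately show ?thesis
      using right[OF uv(1)] right[OF Au] right[OF vec_carrier] adj[OF uv] onesl[OF uv(2)] onesl[OF Av] SA[OF uv(1)] SA[OF uv(2)]
      by simp
  qed
  show ?thesis
    unfolding expand[OF assms(1,2)] expand[OF assms(3,4)] AA[OF assms(1,2)] AA[OF assms(3,4)]
      1 2 3[folded S_def] 4[folded S_def] ..
qed

text \<open>Splitting each vector into its three eigencomponents gives a family of eigenvectors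
  indexed by \<open>I \<times> {0, 1, 2}\<close>; a unitary that matches the components matches
  their sums.\<close>

lemma extension:
  assumes "finite I"
    and x: "\<And>i. i \<in> I \<Longrightarrow> x i \<in> carrier_vec n" and y: "\<And>i. i \<in> I \<Longrightarrow> y i \<in> carrier_vec n"
    and gram: "\<And>i j. i \<in> I \<Longrightarrow> j \<in> I \<Longrightarrow> x i \<bullet>c x j = y i \<bullet>c y j"
      "\<And>i j. i \<in> I \<Longrightarrow> j \<in> I \<Longrightarrow> (A *\<^sub>v x i) \<bullet>c x j = (A *\<^sub>v y i) \<bullet>c y j"
      "\<And>i. i \<in> I \<Longrightarrow> x i \<bullet>c ones_vec n = y i \<bullet>c ones_vec n"
  obtains U where "unitary_mat n U" "U * A = A * U" "\<And>i. i \<in> I \<Longrightarrow> U *\<^sub>v x i = y i"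
proof -
  define eig where "eig t = (if t = 0 then k else if t = 1 then r else s)" for t :: nat
  define d where "d = r - s"
  have d: "d \<noteq> 0" "(of_nat n :: complex) \<noteq> 0" and r: "r = s + d" using rs n by (auto simp: d_def)
  \<comment> \<open>The maps are J/n, (A - sI - ((k - s)/n)J)/(r - s) and (rI - A + ((k - r)/n)J)/(r
    - s): averaging, then the Lagrange projections for \<open>r\<close> and \<open>s\<close> with
    their part along the all-ones vector removed.\<close>
  define E where "E t = (if t = 0 then comb A n 0 0 (1 / of_nat n)
    else if t = 1 then comb A n (- s / d) (1 / d) (- (k - s) / (of_nat n * d))
    else comb A n (r / d) (- 1 / d) ((k - r) / (of_nat n * d)))" for t :: nat
  have E_carrier: "E t z \<in> carrier_vec n" if "z \<in> carrier_vec n" for t z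
    using comb_carrier[OF that] by (simp add: E_def)
  have E_sum: "E 0 z + (E 1 z + E 2 z) = z" if "z \<in> carrier_vec n" for z
  proof (rule eq_vecI)
    fix i assume i: "i < dim_vec z"
    have Ed: "dim_vec (E t z) = n" for t using E_carrier[OF that] by auto
    have 1: "- s / d + r / d = 1" "1 / d + - 1 / d = 0"
      using d by (simp_all add: r field_simps)
    have 2: "- (k - s) / (of_nat n * d) + (k - r) / (of_nat n * d) = - 1 / of_nat n"
      using d by (simp add: r field_simps)
    have "(E 0 z + (E 1 z + E 2 z)) $ i = E 0 z $ i + (E 1 z $ i + E 2 z $ i)"
      using i that Ed by auto
    also have "\<dots> = (- s / d + r / d) * z $ i + ((1 / d + - 1 / d) * (A *\<^sub>v z) $ i
       + (1 / of_nat n + (- (k - s) / (of_nat n * d) + (k - r) / (of_nat n * d))) * (z \<bullet>c ones_vec n))"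
      using i that by (simp add: E_def comb_index[OF that] ring_distribs del: index_mult_mat_vec)
    finally show "(E 0 z + (E 1 z + E 2 z)) $ i = z $ i" unfolding 1 2 by simp
  qed (use E_carrier[OF that] that in auto)
  have E_eigen: "A *\<^sub>v E t z = eig t \<cdot>\<^sub>v E t z" if z: "z \<in> carrier_vec n" for t z
  proof -
    have smult: "e \<cdot>\<^sub>v comb A n \<alpha> \<beta> \<gamma> z = comb A n (e * \<alpha>) (e * \<beta>) (e * \<gamma>) z" for e \<alpha> \<beta> \<gamma>
      using z A by (intro eq_vecI) (auto simp: comb_def algebra_simps)
    \<comment> \<open>This value of \<open>c\<close> makes the J-coefficients agree when A is
      applied to the \<open>r\<close> and \<open>s\<close> components.\<close>
    have c: "c = (k - r) * (k - s) / of_nat n" using k_equation n by (simp add: field_simps)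
    have comb_cong: "comb A n \<alpha> \<beta> \<gamma> z = comb A n \<alpha>' \<beta>' \<gamma>' z"
      if "\<alpha> = \<alpha>'" "\<beta> = \<beta>'" "\<gamma> = \<gamma>'" for \<alpha> \<beta> \<gamma> \<alpha>' \<beta>' \<gamma>'
      using that by simp
    have "A *\<^sub>v comb A n 0 0 (1 / of_nat n) z = k \<cdot>\<^sub>v comb A n 0 0 (1 / of_nat n) z"
      unfolding A_comb[OF z] smult by (rule comb_cong) simp_all
    moreover have "A *\<^sub>v comb A n (- s / d) (1 / d) (- (k - s) / (of_nat n * d)) z =
        r \<cdot>\<^sub>v comb A n (- s / d) (1 / d) (- (k - s) / (of_nat n * d)) z"
      unfolding A_comb[OF z] smult by (rule comb_cong) (use d in \<open>simp_all add: c r field_simps\<close>)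
    moreover have "A *\<^sub>v comb A n (r / d) (- 1 / d) ((k - r) / (of_nat n * d)) z =
        s \<cdot>\<^sub>v comb A n (r / d) (- 1 / d) ((k - r) / (of_nat n * d)) z"
      unfolding A_comb[OF z] smult by (rule comb_cong) (use d in \<open>simp_all add: c r field_simps\<close>)
    ultimately show ?thesis by (simp add: E_def eig_def)
  qed
  have gramE: "E t (x i) \<bullet>c E u (x j) = E t (y i) \<bullet>c E u (y j)" if "i \<in> I" "j \<in> I" for t u i j
    unfolding E_def using that by (auto intro!: comb_prod x y gram)
  have "\<exists>U. unitary_mat n U \<and> U * A = A * U \<and> (\<forall>p\<in>I \<times> {0, 1, 2}. U *\<^sub>v (\<lambda>(i, t). E t (x i)) p = (\<lambda>(i, t). E t (y i)) p)"
    by (rule eigenvector_family_extension[OF A herm, where e = "\<lambda>(i, t). eig t"])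
      (use \<open>finite I\<close> in \<open>auto simp: E_eigen x y gramE intro!: E_carrier\<close>)
  then obtain U where U: "unitary_mat n U" "U * A = A * U"
    "\<And>i t. i \<in> I \<Longrightarrow> t \<in> {0, 1, 2} \<Longrightarrow> U *\<^sub>v E t (x i) = E t (y i)" by auto
  have "U *\<^sub>v x i = y i" if i: "i \<in> I" for i
  proof -
    note C = E_carrier[OF x[OF i]]
    have "U *\<^sub>v x i = U *\<^sub>v (E 0 (x i) + (E 1 (x i) + E 2 (x i)))" by (simp only: E_sum[OF x[OF i]])
    also have "\<dots> = U *\<^sub>v E 0 (x i) + (U *\<^sub>v E 1 (x i) + U *\<^sub>v E 2 (x i))"
      using C unitary_matD(1)[OF U(1)] by (simp add: mult_add_distrib_mat_vec[of U n n])
    finally show ?thesis using E_sum[OF y[OF i]] by (simp add: U(3)[OF i])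
  qed
  thus ?thesis using that U by blast
qed

end

subsection \<open>Conjugation and compression\<close>

lemma gen_alg_carrier:
  assumes "G \<subseteq> carrier_mat n n" "M \<in> gen_alg G"
  shows "M \<in> carrier_mat n n"
  using assms(2) by induction (use assms(1) in auto)

text \<open>Conjugation is multiplicative because the inner \<open>Q * P\<close> cancels, so it can
  be followed through the generation of \<open>M\<close>.\<close>

lemma gen_alg_conjugate:
  assumes P: "P \<in> carrier_mat n n" and Q: "Q \<in> carrier_mat n n" and QP: "Q * P = 1\<^sub>m n"
    and G: "G \<subseteq> carrier_mat n n" and M: "M \<in> gen_alg G"
  shows "P * M * Q \<in> gen_alg ((\<lambda>M. P * M * Q) ` G)"
  using M
proof induction
  case (gen g)
  thus ?case by (auto intro: gen_alg.gen)
next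
  case (add M N)
  note c = gen_alg_carrier[OF G add.hyps(1)] gen_alg_carrier[OF G add.hyps(2)]
  have "P * (M + N) * Q = P * M * Q + P * N * Q"
    using P Q c by (simp add: mult_add_distrib_mat add_mult_distrib_mat[of _ n n])
  thus ?case using gen_alg.add[OF add.IH] by simp
next
  case (mult M N)
  note c = gen_alg_carrier[OF G mult.hyps(1)] gen_alg_carrier[OF G mult.hyps(2)]
  have "P * M * Q * (P * N * Q) = P * (M * ((Q * P) * (N * Q)))"
    using P Q c by (simp add: mult_assoc_dim)
  hence "P * (M * N) * Q = P * M * Q * (P * N * Q)"
    using P Q c by (simp add: QP mult_assoc_dim)
  thus ?case using gen_alg.mult[OF mult.IH] by simp
next
  case (smult M r)
  note c = gen_alg_carrier[OF G smult.hyps]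
  have "P * (r \<cdot>\<^sub>m M) * Q = r \<cdot>\<^sub>m (P * M * Q)"
    using P Q c by (simp add: mult_smult_distrib mult_smult_assoc_mat[of _ n n])
  thus ?case using gen_alg.smult[OF smult.IH] by simp
qed

text \<open>The reverse conjugation returns the conjugated generators to \<open>G\<close>, so the
  preceding lemma, used in both directions, gives mutually inverse maps between the generated
  algebras.\<close>

lemma alg_iso_conjugate:
  assumes P: "P \<in> carrier_mat n n" and Q: "Q \<in> carrier_mat n n" and PQ: "P * Q = 1\<^sub>m n"
    and G: "G \<subseteq> carrier_mat n n"
  shows "alg_iso (gen_alg G) (gen_alg ((\<lambda>M. P * M * Q) ` G)) (\<lambda>M. P * M * Q)"
proof -
  let ?f = "\<lambda>M. P * M * Q" and ?g = "\<lambda>M. Q * M * P"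
  have QP: "Q * P = 1\<^sub>m n" using mat_mult_left_right_inverse[OF P Q PQ] .
  note c = gen_alg_carrier[OF G]
  have fG: "?f ` G \<subseteq> carrier_mat n n" using P Q G by auto
  have gf: "?g (?f M) = M" if M: "M \<in> carrier_mat n n" for M
  proof -
    have "?g (?f M) = (Q * P) * (M * (Q * P))" using P Q M by (simp add: mult_assoc_dim)
    thus ?thesis using M by (simp add: QP)
  qed
  have fg: "?f (?g M) = M" if M: "M \<in> carrier_mat n n" for M
  proof -
    have "?f (?g M) = (P * Q) * (M * (P * Q))" using P Q M by (simp add: mult_assoc_dim)
    thus ?thesis using M by (simp add: PQ)
  qed
  have "?g ` ?f ` G = (\<lambda>M. M) ` G"
    unfolding image_image by (rule image_cong[OF refl]) (use gf G in blast)
  hence "?g ` gen_alg (?f ` G) \<subseteq> gen_alg G"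
    using gen_alg_conjugate[OF Q P PQ fG] by (metis image_ident image_subsetI)
  moreover have "?f ` gen_alg G \<subseteq> gen_alg (?f ` G)"
    using gen_alg_conjugate[OF P Q QP G] by blast
  ultimately have "bij_betw ?f (gen_alg G) (gen_alg (?f ` G))"
    by (intro bij_betw_byWitness[where f' = ?g] ballI gf fg) (auto intro: c gen_alg_carrier[OF fG])
  moreover have "?f (M + N) = ?f M + ?f N \<and> ?f (M * N) = ?f M * ?f N"
    if "M \<in> gen_alg G" "N \<in> gen_alg G" for M N
  proof
    note cM = c[OF that(1)] and cN = c[OF that(2)]
    show "?f (M + N) = ?f M + ?f N"
      using P Q cM cN by (simp add: mult_add_distrib_mat add_mult_distrib_mat[of _ n n])
    have "?f M * ?f N = P * (M * ((Q * P) * (N * Q)))"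
      using P Q cM cN by (simp add: mult_assoc_dim)
    thus "?f (M * N) = ?f M * ?f N" using P Q cM cN by (simp add: QP mult_assoc_dim)
  qed
  moreover have "?f (r \<cdot>\<^sub>m M) = r \<cdot>\<^sub>m ?f M" if "M \<in> gen_alg G" for r M
    using P Q c[OF that] by (simp add: mult_smult_distrib mult_smult_assoc_mat[of _ n n])
  ultimately show ?thesis unfolding alg_iso_def by blast
qed

text \<open>A characteristic polynomial is monic and splits over the complex numbers, so its
  multiset of roots determines it.\<close>

lemma spectrum_mat_eq_iff:
  assumes "M \<in> carrier_mat m m" "N \<in> carrier_mat m m"
  shows "spectrum_mat M = spectrum_mat N \<longleftrightarrow> char_poly M = char_poly N"
proof
  have *: "\<exists>as. char_poly X = (\<Prod>a\<leftarrow>as. [:- a, 1:]) \<and> proots (char_poly X) = mset as"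
    if X: "X \<in> carrier_mat m m" for X :: "complex mat"
  proof -
    obtain as where as: "char_poly X = (\<Prod>a\<leftarrow>as. [:- a, 1:])"
      using char_poly_factorized[OF X] by blast
    have "proots (\<Prod>a\<leftarrow>as. [:- a, 1:]) = mset as" for as :: "complex list"
    proof (induction as)
      case (Cons a as)
      have "(\<Prod>a\<leftarrow>as. [:- a, 1:]) \<noteq> 0" by (auto simp: prod_list_zero_iff)
      thus ?case using Cons.IH by (simp add: proots_mult del: mult_pCons_left)
    qed simp
    thus ?thesis using as by auto
  qed
  assume "spectrum_mat M = spectrum_mat N"
  then obtain as bs where "char_poly M = (\<Prod>a\<leftarrow>as. [:- a, 1:])" "char_poly N = (\<Prod>a\<leftarrow>bs. [:- a, 1:])"
    "mset as = mset bs"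
    using *[OF assms(1)] *[OF assms(2)] by (auto simp: spectrum_mat_def)
  thus "char_poly M = char_poly N"
    by (metis mset_map prod_mset_prod_list)
qed (simp add: spectrum_mat_def)

text \<open>\<open>P\<close> maps the range of \<open>C\<close> onto that of \<open>C'\<close>. In
  the coordinates given by these isometries its restriction is \<open>R\<close>, which conjugates
  one compression into the other.\<close>

lemma compression_char_poly_eq:
  fixes A :: "complex mat"
  assumes A: "A \<in> carrier_mat n n" and P: "P \<in> carrier_mat n n" and Q: "Q \<in> carrier_mat n n"
    and PQ: "P * Q = 1\<^sub>m n" and PA: "P * A = A * P"
    and C: "C \<in> carrier_mat n k" "mat_adjoint C * C = 1\<^sub>m k"
    and C': "C' \<in> carrier_mat n k" "mat_adjoint C' * C' = 1\<^sub>m k"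
    and inter: "P * (C * mat_adjoint C) = (C' * mat_adjoint C') * P"
  shows "char_poly (mat_adjoint C * A * C) = char_poly (mat_adjoint C' * A * C')"
proof -
  define K where "K = mat_adjoint C" define K' where "K' = mat_adjoint C'"
  have K: "K \<in> carrier_mat k n" "K' \<in> carrier_mat k n" using C C' by (auto simp: K_def K'_def)
  note KC = C(2)[folded K_def] C'(2)[folded K'_def]
  define D where "D = C * K" define D' where "D' = C' * K'"
  have D: "D \<in> carrier_mat n n" "D' \<in> carrier_mat n n" using C C' K by (auto simp: D_def D'_def)
  have inter: "P * D = D' * P" using inter by (simp add: D_def D'_def K_def K'_def)
  have KD: "K' * D' = K'"
  proof -
    have "K' * D' = (K' * C') * K'" using C' K by (simp add: D'_def mult_assoc_dim)
    thus ?thesis using K KC by simp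
  qed
  have DC: "D * C = C"
  proof -
    have "D * C = C * (K * C)" using C K by (simp add: D_def mult_assoc_dim)
    thus ?thesis using C K KC by simp
  qed
  have KD2: "K' * (D' * X) = K' * X" if "X \<in> carrier_mat n m" for X m
    using that K D by (simp add: KD mult_assoc_dim[symmetric])
  define R where "R = K' * P * C"
  \<comment> \<open>The inverse of \<open>R\<close> is the restriction of \<open>Q\<close>, from the
    range of \<open>C'\<close> back to that of \<open>C\<close>.\<close>
  define R' where "R' = K * Q * C'"
  note cs = A P Q C(1) C'(1) K D
  have RR: "R * R' = 1\<^sub>m k"
  proof -
    have "R * R' = K' * ((P * D) * (Q * C'))"
      using cs by (simp add: R_def R'_def D_def mult_assoc_dim)
    also have "\<dots> = K' * (D' * ((P * Q) * C'))" unfolding inter using cs by (simp add: mult_assoc_dim)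
    also have "\<dots> = K' * C'" using cs KD2[of C' k] by (simp add: PQ)
    finally show ?thesis using KC by simp
  qed
  \<comment> \<open>The inner \<open>C * K\<close> is the projection \<open>D\<close>; it passes
    through \<open>P\<close> as \<open>D'\<close> and is absorbed by \<open>K'\<close>. Once
    \<open>P\<close> has moved past \<open>A\<close>, \<open>D\<close> is reinserted in front of
    \<open>C\<close> and passes through \<open>P\<close> again.\<close>
  have "R * (K * A * C) = K' * ((P * D) * (A * C))"
    using cs by (simp add: R_def D_def mult_assoc_dim)
  also have "\<dots> = K' * (D' * ((P * A) * C))" unfolding inter using cs by (simp add: mult_assoc_dim)
  also have "\<dots> = K' * ((P * A) * C)" using cs by (intro KD2[of _ k]) auto
  also have "\<dots> = K' * (A * (P * (D * C)))" unfolding PA DC using cs by (simp add: mult_assoc_dim)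
  also have "\<dots> = K' * (A * ((P * D) * C))" using cs by (simp add: mult_assoc_dim)
  also have "\<dots> = (K' * A * C') * R"
    unfolding inter using cs by (simp add: R_def D'_def mult_assoc_dim)
  finally have inter_R: "R * (K * A * C) = (K' * A * C') * R" .
  have cR: "R \<in> carrier_mat k k" "R' \<in> carrier_mat k k" "K' * A * C' \<in> carrier_mat k k" "K * A * C \<in> carrier_mat k k"
    using cs by (auto simp: R_def R'_def)
  have "R * (K * A * C) * R' = (K' * A * C') * (R * R')"
    unfolding inter_R using cR by (intro assoc_mult_mat) auto
  hence eq: "K' * A * C' = R * (K * A * C) * R'" unfolding RR right_mult_one_mat[OF cR(3)] by (rule sym)
  have "similar_mat (K' * A * C') (K * A * C)"
    by (rule similar_matI[of _ _ R R' k]) (use cR RR eq mat_mult_left_right_inverse[OF cR(1,2) RR] in auto)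
  thus ?thesis using char_poly_similar unfolding K_def K'_def by metis
qed

subsection \<open>Connected strongly regular graphs\<close>

locale connected_srg =
  fixes n :: nat and E :: "nat \<Rightarrow> nat \<Rightarrow> bool" and k a c :: nat
  assumes srg: "strongly_regular n E k a c" and conn: "connected_graph n E"
begin

abbreviation nbrs :: "nat \<Rightarrow> nat set" where "nbrs x \<equiv> {y. y < n \<and> E x y}"

lemma E_sym: "x < n \<Longrightarrow> y < n \<Longrightarrow> E x y \<longleftrightarrow> E y x"
  and E_irrefl: "x < n \<Longrightarrow> \<not> E x x"
  using srg by (auto simp: strongly_regular_def simple_graph_def)

lemma card_nbrs: "x < n \<Longrightarrow> card (nbrs x) = k"
  using srg by (auto simp: strongly_regular_def)

lemma card_common_nbrs:
  assumes "x < n" "y < n"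
  shows "card (nbrs x \<inter> nbrs y) = (if x = y then k else if E x y then a else c)"
proof -
  have "nbrs x \<inter> nbrs y = {z. z < n \<and> E x z \<and> E y z}" by auto
  hence "card (nbrs x \<inter> nbrs y) = common_nbrs n E x y" by (simp add: common_nbrs_def)
  thus ?thesis
    using srg assms card_nbrs[OF assms(1)] by (auto simp: strongly_regular_def common_nbrs_def)
qed

text \<open>An edge from y to z leaving the closed neighbourhood of \<open>x\<close> would make y a
  common neighbour of the non-adjacent \<open>x\<close> and z, against \<open>c = 0\<close>. Hence a
  connected graph with \<open>c = 0\<close> is complete.\<close>

lemma rtrancl_nbr:
  assumes "c = 0" "x < n" "(x, y) \<in> (edge_rel n E)\<^sup>*"
  shows "y = x \<or> E x y"
  using assms(3)
proof induction
  case (step y z)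
  have yz: "y < n" "z < n" "E y z" using step.hyps by (auto simp: edge_rel_def)
  show ?case
  proof (rule ccontr)
    assume *: "\<not> (z = x \<or> E x z)"
    hence "y \<in> nbrs x \<inter> nbrs z" using step.IH yz E_sym[of y z] by auto
    moreover have "card (nbrs x \<inter> nbrs z) = 0"
      using card_common_nbrs[OF assms(2) yz(2)] * assms(1) by auto
    ultimately show False by auto
  qed
qed simp

lemma common_nbr_exists:
  assumes "x < n" "y < n" "x \<noteq> y" "\<not> E x y"
  obtains z where "z < n" "E x z" "E z y"
proof -
  have "(x, y) \<in> (edge_rel n E)\<^sup>*" using conn assms by (auto simp: connected_graph_def)
  hence "c \<noteq> 0" using rtrancl_nbr[of x y] assms by auto
  hence "nbrs x \<inter> nbrs y \<noteq> {}"
    using card_common_nbrs[OF assms(1,2)] assms(3,4) by (auto simp del: Int_iff dest!: arg_cong[of _ _ card])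
  thus ?thesis using that E_sym assms by auto
qed

text \<open>Distinct non-adjacent vertices have a common neighbour, so no distance exceeds 2. This
  makes all dual idempotents explicit.\<close>

lemma gdist_eq:
  assumes "x < n" "y < n"
  shows "gdist n E x y = (if x = y then 0 else if E x y then 1 else 2)"
proof -
  have 1: "(x, y) \<in> edge_rel n E ^^ 1 \<longleftrightarrow> E x y"
    using assms by (auto simp: edge_rel_def)
  consider "x = y" | "x \<noteq> y" "E x y" | "x \<noteq> y" "\<not> E x y" by blast
  thus ?thesis
  proof cases
    case 1
    thus ?thesis by (auto simp: gdist_def intro!: Least_equality)
  next
    case 2
    have "gdist n E x y = 1" unfolding gdist_def
    proof (rule Least_equality)
      fix m assume "(x, y) \<in> edge_rel n E ^^ m"
      thus "1 \<le> m" using 2 by (cases m) auto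
    qed (use 1 2 in auto)
    thus ?thesis using 2 by simp
  next
    case 3
    obtain z where "z < n" "E x z" "E z y" using common_nbr_exists[OF assms 3] .
    hence "(x, y) \<in> edge_rel n E ^^ 2"
      using assms by (auto simp: numeral_2_eq_2 edge_rel_def intro!: relcompI)
    have "gdist n E x y = 2" unfolding gdist_def
    proof (rule Least_equality)
      fix m assume m: "(x, y) \<in> edge_rel n E ^^ m"
      have "m \<noteq> 0" using m 3 by (auto intro: ccontr)
      moreover have "m \<noteq> 1" using m 1 3 by metis
      ultimately show "2 \<le> m" by simp
    qed fact
    thus ?thesis using 3 by simp
  qed
qed

lemma nbr_exists:
  assumes "x < n" "y < n" "x \<noteq> y"
  obtains z where "z < n" "E x z"
  using common_nbr_exists[OF assms] assms by blast

text \<open>\<open>pseudo_vertex_transitive\<close> constrains the dual idempotents only up to the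
  diameter; this bound gives access to index 1.\<close>

lemma diameter_ge_1:
  assumes "x < n" "y < n" "x \<noteq> y"
  shows "1 \<le> diameter n E"
proof -
  obtain z where z: "z < n" "E x z" using nbr_exists[OF assms] .
  hence "gdist n E x z = 1" using gdist_eq[OF assms(1) z(1)] E_irrefl[OF assms(1)] by auto
  moreover have "{gdist n E x y | x y. x < n \<and> y < n} = (\<lambda>(x, y). gdist n E x y) ` ({..<n} \<times> {..<n})" by auto
  hence "finite {gdist n E x y | x y. x < n \<and> y < n}" by simp
  ultimately show ?thesis
    unfolding diameter_def using assms(1) z(1) by (intro Max_ge) (auto, metis)
qed

section \<open>The adjacency matrix and its quadratic relation\<close>

definition A :: "complex mat" where "A = adj_mat n E"

lemma A_carrier [simp]: "A \<in> carrier_mat n n"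
  and A_dim [simp]: "dim_row A = n" "dim_col A = n"
  by (auto simp: A_def adj_mat_def)

lemma A_index: "x < n \<Longrightarrow> y < n \<Longrightarrow> A $$ (x, y) = (if E x y then 1 else 0)"
  by (simp add: A_def adj_mat_def)

lemma A_adjoint: "mat_adjoint A = A"
  by (rule eq_matI) (auto simp: A_index E_sym)

lemma sum_indicator: "(\<Sum>z<n. if P z then 1 else 0) = (of_nat (card {z. z < n \<and> P z}) :: complex)"
  by (simp add: sum.If_cases lessThan_def Collect_conj_eq)

lemma A_ones: "A *\<^sub>v ones_vec n = of_nat k \<cdot>\<^sub>v ones_vec n"
proof (rule eq_vecI)
  fix i assume "i < dim_vec (of_nat k \<cdot>\<^sub>v ones_vec n :: complex vec)"
  hence i: "i < n" by simp
  have "(A *\<^sub>v ones_vec n) $ i = (\<Sum>z<n. if E i z then 1 else 0)"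
    using i by (simp add: mult_mat_vec_sum A_index del: index_mult_mat_vec)
  thus "(A *\<^sub>v ones_vec n) $ i = (of_nat k \<cdot>\<^sub>v ones_vec n) $ i"
    using i by (simp add: sum_indicator card_nbrs)
qed simp

lemma A_square_index:
  assumes "x < n" "y < n"
  shows "(A * A) $$ (x, y) = (if x = y then of_nat k else if E x y then of_nat a else of_nat c)"
proof -
  have "(A * A) $$ (x, y) = (\<Sum>z<n. if E x z \<and> E y z then 1 else 0)"
    using assms by (subst mult_mat_sum) (auto simp: A_index E_sym intro!: sum.cong)
  also have "\<dots> = of_nat (card (nbrs x \<inter> nbrs y))"
    unfolding sum_indicator by (intro arg_cong[where f = of_nat] arg_cong[where f = card]) auto
  finally show ?thesis using card_common_nbrs[OF assms] by simp
qed

text \<open>In matrix form this is A^2 = kI + aA + c(J - I - A), with the coefficients of I, A and J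
  collected.\<close>

lemma A_square:
  assumes z: "z \<in> carrier_vec n"
  shows "A *\<^sub>v (A *\<^sub>v z) = comb A n (of_nat k - of_nat c) (of_nat a - of_nat c) (of_nat c) z"
proof (rule eq_vecI)
  fix i assume "i < dim_vec (comb A n (of_nat k - of_nat c) (of_nat a - of_nat c) (of_nat c) z)"
  hence i: "i < n" by (simp add: comb_def)
  have zd: "dim_vec z = n" using z by simp
  have "(A *\<^sub>v (A *\<^sub>v z)) $ i = ((A * A) *\<^sub>v z) $ i"
    using z by (simp add: mult_vec_assoc_dim)
  also have "\<dots> = (\<Sum>j<n. (A * A) $$ (i, j) * z $ j)"
    using i z by (subst mult_mat_vec_sum) auto
  also have "\<dots> = (\<Sum>j<n. (if j = i then (of_nat k - of_nat c) * z $ j else 0)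
      + ((of_nat a - of_nat c) * (A $$ (i, j) * z $ j) + of_nat c * z $ j))"
    using i by (intro sum.cong) (auto simp: A_square_index A_index E_irrefl algebra_simps simp del: index_mult_mat)
  also have "\<dots> = (of_nat k - of_nat c) * z $ i + ((of_nat a - of_nat c) * (A *\<^sub>v z) $ i + of_nat c * (z \<bullet>c ones_vec n))"
    using i zd by (simp add: sum.distrib sum_distrib_left[symmetric] mult_mat_vec_sum cscalar_prod_sum del: index_mult_mat_vec)
  finally show "(A *\<^sub>v (A *\<^sub>v z)) $ i = comb A n (of_nat k - of_nat c) (of_nat a - of_nat c) (of_nat c) z $ i"
    using i zd by (simp add: comb_def del: index_mult_mat_vec)
qed (simp add: comb_def)

text \<open>Take for \<open>r\<close> and \<open>s\<close> the roots of t^2 - (a - c)t - (k - c).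
  The work lies in showing that they differ.\<close>

lemma three_eigenvalues:
  assumes "x < n" "y < n" "x \<noteq> y" "c \<le> k"
  obtains r s where "three_eigenvalues A n (of_nat k) r s (of_nat c)"
proof -
  obtain z where z: "z < n" "E x z" using nbr_exists[OF assms(1-3)] .
  \<comment> \<open>\<open>z\<close> is a neighbour of \<open>x\<close> but not of itself, so the
    common neighbours form a proper subset of the neighbours of \<open>x\<close>.\<close>
  have "a < k"
  proof -
    have "card (nbrs x \<inter> nbrs z) < card (nbrs x)"
      using z E_irrefl[OF z(1)] by (intro psubset_card_mono) auto
    thus ?thesis using card_common_nbrs[OF assms(1) z(1)] card_nbrs[OF assms(1)] z E_irrefl[OF z(1)] by (auto split: if_splits)
  qed
  \<comment> \<open>The discriminant, as an integer with both summands nonnegative by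
    \<open>c \<le> k\<close>. If it vanished, then a = c = k, contradicting
    \<open>a < k\<close>.\<close>
  define \<delta> :: int where "\<delta> = (int a - int c)\<^sup>2 + 4 * (int k - int c)"
  have "\<delta> \<noteq> 0"
  proof
    have *: "u = 0 \<and> v = 0" if "u + 4 * v = 0" "0 \<le> u" "0 \<le> v" for u v :: int
      using that by presburger
    assume "\<delta> = 0"
    hence "(int a - int c)\<^sup>2 = 0 \<and> int k - int c = 0"
      unfolding \<delta>_def by (rule *) (use assms(4) in simp_all)
    thus False using \<open>a < k\<close> by simp
  qed
  define d where "d = csqrt (of_int \<delta>)"
  have dd: "d * d = (of_nat a - of_nat c)\<^sup>2 + 4 * (of_nat k - of_nat c)"
    using power2_csqrt[of "of_int \<delta>"] by (simp add: d_def power2_eq_square \<delta>_def)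
  have "d \<noteq> 0" using \<open>\<delta> \<noteq> 0\<close> by (simp add: d_def)
  define r where "r = (of_nat a - of_nat c + d) / 2"
  define s where "s = (of_nat a - of_nat c - d) / 2"
  have "- r * s = (d * d - (of_nat a - of_nat c)\<^sup>2) / 4"
    by (simp add: r_def s_def field_simps power2_eq_square)
  also have "\<dots> = of_nat k - of_nat c" unfolding dd by simp
  finally have "- r * s = of_nat k - of_nat c" .
  moreover have "r + s = of_nat a - of_nat c" by (simp add: r_def s_def field_simps)
  moreover have "r \<noteq> s" using \<open>d \<noteq> 0\<close> by (simp add: r_def s_def)
  ultimately have "three_eigenvalues A n (of_nat k) r s (of_nat c)"
    using assms(1) A_adjoint A_ones A_square by unfold_locales auto
  thus ?thesis by (rule that)
qed

section \<open>Neighbourhoods and local adjacency matrices\<close>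

abbreviation nbr :: "nat \<Rightarrow> nat \<Rightarrow> nat" where "nbr x i \<equiv> nbr_list n E x ! i"

lemma nbr_list_props:
  assumes "x < n"
  shows "set (nbr_list n E x) = nbrs x" "distinct (nbr_list n E x)" "length (nbr_list n E x) = k"
proof -
  have "finite (nbrs x)" by simp
  thus "set (nbr_list n E x) = nbrs x" "distinct (nbr_list n E x)"
    by (auto simp: nbr_list_def)
  thus "length (nbr_list n E x) = k"
    using distinct_card card_nbrs[OF assms] by metis
qed

lemma nbr_bij: "x < n \<Longrightarrow> bij_betw (nbr x) {..<k} (nbrs x)"
  using bij_betw_nth[of "nbr_list n E x" "{..<k}" "nbrs x"] nbr_list_props by auto

lemma nbr_nbrs:
  assumes "x < n" "i < k"
  shows "nbr x i < n" "E x (nbr x i)" "x \<noteq> nbr x i"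
proof -
  have "nbr x i \<in> nbrs x" using bij_betwE[OF nbr_bij[OF assms(1)]] assms(2) by blast
  thus "nbr x i < n" "E x (nbr x i)" "x \<noteq> nbr x i" using E_irrefl[OF assms(1)] by auto
qed

lemma nbr_eq_iff: "x < n \<Longrightarrow> i < k \<Longrightarrow> j < k \<Longrightarrow> nbr x i = nbr x j \<longleftrightarrow> i = j"
  using bij_betw_imp_inj_on[OF nbr_bij] by (auto simp: inj_on_def)

text \<open>The isometric inclusion of the coordinates on the neighbours, in the order of
  \<open>nbr_list\<close>, into those on all vertices. It factors the distance-1 idempotent and
  compresses \<open>A\<close> to the local adjacency matrix.\<close>

definition C :: "nat \<Rightarrow> complex mat" where
  "C x = mat n k (\<lambda>(z, i). if z = nbr x i then 1 else 0)"

lemma C_carrier [simp]: "C x \<in> carrier_mat n k"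
  and C_dim [simp]: "dim_row (C x) = n" "dim_col (C x) = k"
  by (auto simp: C_def)

lemma C_index: "z < n \<Longrightarrow> i < k \<Longrightarrow> C x $$ (z, i) = (if z = nbr x i then 1 else 0)"
  by (simp add: C_def)

lemma sum_unit: "m < n \<Longrightarrow> (\<Sum>z<n. cnj (if z = m then 1 else 0) * f z) = f m"
proof -
  assume "m < n"
  have "(\<Sum>z<n. cnj (if z = m then 1 else 0) * f z) = (\<Sum>z<n. if z = m then f z else 0)"
    by (intro sum.cong) auto
  thus ?thesis using \<open>m < n\<close> by simp
qed

lemma C_adjoint_mult:
  assumes "x < n" "M \<in> carrier_mat n m" "i < k" "j < m"
  shows "(mat_adjoint (C x) * M) $$ (i, j) = M $$ (nbr x i, j)"
  using assms nbr_nbrs(1)[OF assms(1,3)] by (subst mult_mat_sum) (auto simp: C_index sum_unit)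

lemma C_adjoint_mult_vec:
  assumes "x < n" "z \<in> carrier_vec n"
  shows "mat_adjoint (C x) *\<^sub>v z = vec k (\<lambda>i. z $ nbr x i)"
proof (rule eq_vecI)
  fix i assume "i < dim_vec (vec k (\<lambda>i. z $ nbr x i))"
  hence i: "i < k" by simp
  thus "(mat_adjoint (C x) *\<^sub>v z) $ i = vec k (\<lambda>i. z $ nbr x i) $ i"
    using assms nbr_nbrs(1)[OF assms(1) i] by (subst mult_mat_vec_sum) (auto simp: C_index sum_unit)
qed simp

lemma C_orthonormal: "x < n \<Longrightarrow> mat_adjoint (C x) * C x = 1\<^sub>m k"
  by (rule eq_matI) (auto simp: C_adjoint_mult[OF _ C_carrier] nbr_nbrs nbr_eq_iff C_index simp del: index_mult_mat(1))

lemma local_carrier: "x < n \<Longrightarrow> local_adj_mat n E x \<in> carrier_mat k k"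
  by (simp add: local_adj_mat_def nbr_list_props Let_def)

lemma local_index:
  "x < n \<Longrightarrow> i < k \<Longrightarrow> j < k \<Longrightarrow> local_adj_mat n E x $$ (i, j) = (if E (nbr x i) (nbr x j) then 1 else 0)"
  by (simp add: local_adj_mat_def nbr_list_props Let_def)

lemma local_compression:
  assumes "x < n"
  shows "local_adj_mat n E x = mat_adjoint (C x) * A * C x"
proof (rule eq_matI)
  fix i j assume "i < dim_row (mat_adjoint (C x) * A * C x)" "j < dim_col (mat_adjoint (C x) * A * C x)"
  hence ij: "i < k" "j < k" by auto
  have "(mat_adjoint (C x) * A * C x) $$ (i, j) = (A * C x) $$ (nbr x i, j)"
    using C_adjoint_mult[OF assms mult_carrier_mat[OF A_carrier C_carrier] ij]
    by (simp add: mult_assoc_dim del: index_mult_mat(1))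
  also have "\<dots> = (\<Sum>z<n. A $$ (nbr x i, z) * (if z = nbr x j then 1 else 0))"
    using ij nbr_nbrs(1)[OF assms] by (subst mult_mat_sum) (auto simp: C_index)
  also have "\<dots> = (\<Sum>z<n. cnj (if z = nbr x j then 1 else 0) * A $$ (nbr x i, z))"
    by (intro sum.cong) auto
  also have "\<dots> = local_adj_mat n E x $$ (i, j)"
    using ij nbr_nbrs(1)[OF assms] assms by (simp add: sum_unit A_index local_index)
  finally show "local_adj_mat n E x $$ (i, j) = (mat_adjoint (C x) * A * C x) $$ (i, j)" by simp
qed (use local_carrier[OF assms] in auto)

lemma local_adjoint: "x < n \<Longrightarrow> mat_adjoint (local_adj_mat n E x) = local_adj_mat n E x"
  by (simp add: local_compression mat_adjoint_mult A_adjoint mult_assoc_dim)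

text \<open>Inside the local graph at \<open>x\<close>, the neighbours of a vertex are its common
  neighbours with \<open>x\<close>, so the local graph is \<open>a\<close>-regular.\<close>

lemma local_ones:
  assumes "x < n"
  shows "local_adj_mat n E x *\<^sub>v ones_vec k = of_nat a \<cdot>\<^sub>v ones_vec k"
proof (rule eq_vecI)
  fix i assume "i < dim_vec (of_nat a \<cdot>\<^sub>v ones_vec k :: complex vec)"
  hence i: "i < k" by simp
  note ni = nbr_nbrs[OF assms i]
  have "(local_adj_mat n E x *\<^sub>v ones_vec k) $ i = (\<Sum>j<k. if E (nbr x i) (nbr x j) then 1 else 0)"
    using i assms local_carrier[OF assms] by (subst mult_mat_vec_sum) (auto simp: local_index intro!: sum.cong)
  also have "\<dots> = (\<Sum>w\<in>nbrs x. if E (nbr x i) w then 1 else 0)"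
    by (rule sum.reindex_bij_betw[OF nbr_bij[OF assms]])
  also have "\<dots> = of_nat (card (nbrs x \<inter> nbrs (nbr x i)))"
    by (auto simp: sum.If_cases intro!: arg_cong[where f = card])
  finally show "(local_adj_mat n E x *\<^sub>v ones_vec k) $ i = (of_nat a \<cdot>\<^sub>v ones_vec k) $ i"
    using i ni card_common_nbrs[OF assms ni(1)] by simp
qed (use local_carrier[OF assms] in auto)

section \<open>Dual idempotents\<close>

text \<open>One-column counterpart of \<open>C\<close>, giving the distance-0 idempotent the shape
  required by \<open>unitary_intertwines_projections\<close>.\<close>

definition vertex_mat :: "nat \<Rightarrow> complex mat" where
  "vertex_mat x = mat n 1 (\<lambda>(z, i). if z = x then 1 else 0)"

lemma dual_idem_0: "x < n \<Longrightarrow> dual_idem n E x 0 = vertex_mat x * mat_adjoint (vertex_mat x)"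
  by (rule eq_matI) (auto simp: dual_idem_def vertex_mat_def gdist_eq scalar_prod_def)

lemma dual_idem_1:
  assumes "x < n"
  shows "dual_idem n E x 1 = C x * mat_adjoint (C x)"
proof (rule eq_matI)
  fix y z assume "y < dim_row (C x * mat_adjoint (C x))" "z < dim_col (C x * mat_adjoint (C x))"
  hence yz: "y < n" "z < n" by auto
  have "(C x * mat_adjoint (C x)) $$ (y, z) = (\<Sum>i<k. if nbr x i = y \<and> nbr x i = z then 1 else 0)"
    using yz by (subst mult_mat_sum) (auto simp: C_def intro!: sum.cong)
  also have "\<dots> = (\<Sum>w\<in>nbrs x. if w = y \<and> w = z then 1 else 0)"
    by (rule sum.reindex_bij_betw[OF nbr_bij[OF assms]])
  also have "\<dots> = (if y = z \<and> E x y then 1 else 0)"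
  proof (cases "y = z")
    case True
    thus ?thesis using yz by (simp add: sum.delta)
  next
    case False
    thus ?thesis by (auto intro!: sum.neutral)
  qed
  finally show "dual_idem n E x 1 $$ (y, z) = (C x * mat_adjoint (C x)) $$ (y, z)"
    using yz assms E_irrefl by (auto simp: dual_idem_def gdist_eq)
qed (auto simp: dual_idem_def)

text \<open>Intertwining at distances 0 and 1 thereby settles distance 2.\<close>

lemma dual_idem_2: "x < n \<Longrightarrow> dual_idem n E x 2 = 1\<^sub>m n - (dual_idem n E x 0 + dual_idem n E x 1)"
  by (rule eq_matI) (auto simp: dual_idem_def gdist_eq)

lemma dual_idem_ge_3: "x < n \<Longrightarrow> i \<ge> 3 \<Longrightarrow> dual_idem n E x i = 0\<^sub>m n n"
  by (rule eq_matI) (auto simp: dual_idem_def gdist_eq)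

lemma dual_idem_carrier [simp]: "dual_idem n E x i \<in> carrier_mat n n"
  by (simp add: dual_idem_def)

section \<open>Unitary intertwiners from equal local spectra\<close>

lemma unitary_intertwiner:
  assumes x: "x < n" and y: "y < n" and "x \<noteq> y" "c \<le> k"
    and spec: "spectrum_mat (local_adj_mat n E x) = spectrum_mat (local_adj_mat n E y)"
  obtains U where "unitary_mat n U" "U * A = A * U"
    "\<And>i. U * dual_idem n E x i = dual_idem n E y i * U"
proof -
  define L where "L = local_adj_mat n E x"
  have L: "L \<in> carrier_mat k k" using local_carrier[OF x] by (simp add: L_def)
  \<comment> \<open>\<open>W\<close> can be made to fix the all-ones vector because both local
    graphs are \<open>a\<close>-regular on \<open>k\<close> vertices.\<close>
  obtain W where W: "unitary_mat k W" "W * L = local_adj_mat n E y * W" "W *\<^sub>v ones_vec k = ones_vec k"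
    using hermitian_unitarily_similar_eigenvector[OF local_carrier[OF x] local_adjoint[OF x]
      local_carrier[OF y] local_adjoint[OF y] _ vec_carrier local_ones[OF x] vec_carrier local_ones[OF y] refl]
      spec spectrum_mat_eq_iff[OF local_carrier[OF x] local_carrier[OF y]] unfolding L_def by metis
  \<comment> \<open>\<open>None\<close> stands for the base vertex, \<open>Some i\<close> for the
    i-th neighbour after applying \<open>V\<close> within the neighbourhood. The families to be
    compared have \<open>V\<close> the identity at \<open>x\<close> and \<open>V = W\<close> at
    \<open>y\<close>.\<close>
  define F where "F V z p = (case p of None \<Rightarrow> unit_vec n z | Some i \<Rightarrow> C z *\<^sub>v (V *\<^sub>v unit_vec k i))" for V z and p :: "nat option"
  define I where "I = insert None (Some ` {..<k})"
  \<comment> \<open>The right-hand sides mention neither \<open>z\<close> nor \<open>V\<close>, and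
    \<open>L\<close> always belongs to \<open>x\<close>, so the two families automatically have
    equal inner products.\<close>
  have gram: "F V z p \<in> carrier_vec n"
      "F V z p \<bullet>c F V z q = (if p = q then 1 else 0)"
      "(A *\<^sub>v F V z p) \<bullet>c F V z q = (case p of None \<Rightarrow> (if q = None then 0 else 1)
         | Some i \<Rightarrow> (case q of None \<Rightarrow> 1 | Some j \<Rightarrow> (L *\<^sub>v unit_vec k i) $ j))"
      "F V z p \<bullet>c ones_vec n = 1"
    if z: "z < n" and V: "unitary_mat k V" "V * L = local_adj_mat n E z * V" "V *\<^sub>v ones_vec k = ones_vec k"
      and pq: "p \<in> I" "q \<in> I" for z V p q
  proof -
    note D = unitary_matD[OF V(1)]
    define w where "w i = V *\<^sub>v unit_vec k i" for i
    have w: "w i \<in> carrier_vec k" "dim_vec (w i) = k" for i using D by (auto simp: w_def)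
    have Cw: "C z *\<^sub>v w i \<in> carrier_vec n" for i using w by (meson C_carrier mult_mat_vec_carrier)
    have Cw_left: "u \<bullet>c (C z *\<^sub>v w i) = (mat_adjoint (C z) *\<^sub>v u) \<bullet>c w i" if "u \<in> carrier_vec n" for u i
      using cscalar_prod_adjoint[of "mat_adjoint (C z)" u "w i"] that w by auto
    have ww: "w i \<bullet>c w j = (if i = j then 1 else 0)" if "i < k" "j < k" for i j
      unfolding w_def using unitary_mat_cscalar_prod[OF V(1), of "unit_vec k i" "unit_vec k j"] that by simp
    \<comment> \<open>\<open>V\<close> preserves inner products and fixes the all-ones vector, so
      \<open>w i\<close> has the same product with that vector as a unit vector.\<close>
    have ow: "ones_vec k \<bullet>c w i = 1" if "i < k" for i
    proof -
      have "(V *\<^sub>v ones_vec k) \<bullet>c (V *\<^sub>v unit_vec k i) = ones_vec k \<bullet>c unit_vec k i"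
        by (rule unitary_mat_cscalar_prod[OF V(1)]) auto
      also have "\<dots> = cnj (unit_vec k i \<bullet>c ones_vec k)" by (rule cscalar_prod_commute) simp
      finally show ?thesis using that by (simp add: V(3) w_def)
    qed
    have "mat_adjoint (C z) *\<^sub>v unit_vec n z = 0\<^sub>v k"
      unfolding C_adjoint_mult_vec[OF z unit_vec_carrier] using z nbr_nbrs(1)[OF z] nbr_nbrs(3)[OF z, THEN not_sym]
      by (intro eq_vecI) auto
    hence e_C: "unit_vec n z \<bullet>c (C z *\<^sub>v w i) = 0" for i
      using Cw_left[of "unit_vec n z"] w by simp
    have Ae: "A *\<^sub>v unit_vec n z \<in> carrier_vec n" by (meson A_carrier mult_mat_vec_carrier unit_vec_carrier)
    have "mat_adjoint (C z) *\<^sub>v (A *\<^sub>v unit_vec n z) = ones_vec k"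
      unfolding C_adjoint_mult_vec[OF z Ae] using z nbr_nbrs[OF z]
      by (intro eq_vecI) (auto simp: A_index E_sym)
    hence Ae_C: "(A *\<^sub>v unit_vec n z) \<bullet>c (C z *\<^sub>v w i) = 1" if "i < k" for i
      using Cw_left[OF Ae] ow that by simp
    have AC_e: "(A *\<^sub>v (C z *\<^sub>v w i)) \<bullet>c unit_vec n z = 1" if "i < k" for i
    proof -
      have "(A *\<^sub>v (C z *\<^sub>v w i)) \<bullet>c unit_vec n z = (C z *\<^sub>v w i) \<bullet>c (A *\<^sub>v unit_vec n z)"
        using cscalar_prod_adjoint[of A "C z *\<^sub>v w i" "unit_vec n z"] by (simp add: A_adjoint)
      also have "\<dots> = cnj ((A *\<^sub>v unit_vec n z) \<bullet>c (C z *\<^sub>v w i))"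
        by (rule cscalar_prod_commute) simp
      finally show ?thesis using Ae_C[OF that] by simp
    qed
    have CC: "(C z *\<^sub>v w i) \<bullet>c (C z *\<^sub>v w j) = w i \<bullet>c w j" for i j
      using Cw_left[OF Cw] w by (simp add: mult_vec_assoc_dim C_orthonormal[OF z])
    \<comment> \<open>Moving \<open>C z\<close> across compresses \<open>A\<close> to the local
      matrix at \<open>z\<close>; there \<open>V\<close> is exchanged for \<open>L\<close> by
      intertwining and then cancelled by unitarity.\<close>
    have ACC: "(A *\<^sub>v (C z *\<^sub>v w i)) \<bullet>c (C z *\<^sub>v w j) = (L *\<^sub>v unit_vec k i) $ j" if "i < k" "j < k" for i j
    proof -
      have "A *\<^sub>v (C z *\<^sub>v w i) \<in> carrier_vec n" by (meson A_carrier Cw mult_mat_vec_carrier)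
      hence "(A *\<^sub>v (C z *\<^sub>v w i)) \<bullet>c (C z *\<^sub>v w j) = (mat_adjoint (C z) *\<^sub>v (A *\<^sub>v (C z *\<^sub>v w i))) \<bullet>c w j"
        by (rule Cw_left)
      also have "mat_adjoint (C z) *\<^sub>v (A *\<^sub>v (C z *\<^sub>v w i)) = local_adj_mat n E z *\<^sub>v w i"
        by (simp add: w(2) local_compression[OF z] mult_vec_assoc_dim mult_assoc_dim del: assoc_mult_mat_vec)
      also have "\<dots> = (V * L) *\<^sub>v unit_vec k i"
        unfolding V(2) w_def using D local_carrier[OF z] by (intro assoc_mult_mat_vec[symmetric]) auto
      also have "\<dots> = V *\<^sub>v (L *\<^sub>v unit_vec k i)"
        using D L by (intro assoc_mult_mat_vec) auto
      also have "\<dots> \<bullet>c w j = (L *\<^sub>v unit_vec k i) \<bullet>c unit_vec k j"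
        unfolding w_def using L that by (intro unitary_mat_cscalar_prod[OF V(1)]) auto
      also have "\<dots> = (L *\<^sub>v unit_vec k i) $ j"
        unfolding conjugate_unit_vec using that by (intro scalar_prod_right_unit)
      finally show ?thesis .
    qed
    have C1: "(C z *\<^sub>v w i) \<bullet>c ones_vec n = 1" if "i < k" for i
    proof -
      have "mat_adjoint (C z) *\<^sub>v ones_vec n = ones_vec k"
        unfolding C_adjoint_mult_vec[OF z vec_carrier] using nbr_nbrs[OF z] by (intro eq_vecI) auto
      hence "(C z *\<^sub>v w i) \<bullet>c ones_vec n = w i \<bullet>c ones_vec k"
        using cscalar_prod_adjoint[of "C z" "w i" "ones_vec n"] w by simp
      also have "\<dots> = cnj (ones_vec k \<bullet>c w i)" using w by (intro cscalar_prod_commute) auto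
      finally show ?thesis using ow[OF that] by simp
    qed
    have C_e: "(C z *\<^sub>v w i) \<bullet>c unit_vec n z = 0" for i
      using cscalar_prod_commute[of "C z *\<^sub>v w i" "unit_vec n z"] e_C[of i] by simp
    have ee: "unit_vec n z \<bullet>c unit_vec n z = (1::complex)" "(A *\<^sub>v unit_vec n z) \<bullet>c unit_vec n z = 0"
        "unit_vec n z \<bullet>c ones_vec n = (1::complex)"
      using z E_irrefl[OF z] by (simp_all add: A_index conjugate_unit_vec)
    show "F V z p \<in> carrier_vec n" using Cw by (auto simp: F_def w_def[symmetric] split: option.split)
    show "F V z p \<bullet>c F V z q = (if p = q then 1 else 0)"
      using pq by (auto simp: F_def I_def w_def[symmetric] CC ww e_C C_e ee split: option.split)
    show "(A *\<^sub>v F V z p) \<bullet>c F V z q = (case p of None \<Rightarrow> (if q = None then 0 else 1)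
         | Some i \<Rightarrow> (case q of None \<Rightarrow> 1 | Some j \<Rightarrow> (L *\<^sub>v unit_vec k i) $ j))"
      using pq by (auto simp: F_def I_def w_def[symmetric] ACC Ae_C AC_e ee split: option.split)
    show "F V z p \<bullet>c ones_vec n = 1"
      using pq by (auto simp: F_def I_def w_def[symmetric] C1 ee split: option.split)
  qed
  have one: "unitary_mat k (1\<^sub>m k)" "1\<^sub>m k * L = local_adj_mat n E x * 1\<^sub>m k" "1\<^sub>m k *\<^sub>v ones_vec k = ones_vec k"
    using L by (auto simp: unitary_mat_one L_def)
  note gx = gram[OF x one] and gy = gram[OF y W]
  obtain r s where "three_eigenvalues A n (of_nat k) r s (of_nat c)"
    using three_eigenvalues[OF x y assms(3,4)] .
  then interpret three_eigenvalues A n "of_nat k" r s "of_nat c" .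
  have fin: "finite I" by (simp add: I_def)
  have Fc: "F (1\<^sub>m k) x p \<in> carrier_vec n" "F W y p \<in> carrier_vec n"
    and F1: "F (1\<^sub>m k) x p \<bullet>c ones_vec n = F W y p \<bullet>c ones_vec n" if "p \<in> I" for p
    using gx(1,4)[OF that that] gy(1,4)[OF that that] by simp_all
  have F2: "F (1\<^sub>m k) x p \<bullet>c F (1\<^sub>m k) x q = F W y p \<bullet>c F W y q"
      "(A *\<^sub>v F (1\<^sub>m k) x p) \<bullet>c F (1\<^sub>m k) x q = (A *\<^sub>v F W y p) \<bullet>c F W y q"
    if "p \<in> I" "q \<in> I" for p q
    unfolding gx(2,3)[OF that] gy(2,3)[OF that] by (rule refl)+
  obtain U where U: "unitary_mat n U" "U * A = A * U" "\<And>p. p \<in> I \<Longrightarrow> U *\<^sub>v F (1\<^sub>m k) x p = F W y p"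
    using extension[of I "F (1\<^sub>m k) x" "F W y", OF fin Fc F2 F1] by blast
  note D = unitary_matD[OF U(1)] and DW = unitary_matD[OF W(1)]
  have "U * vertex_mat x = vertex_mat y"
  proof (rule mat_eq_unit_vecI)
    fix i :: nat assume "i < 1"
    have v: "vertex_mat z *\<^sub>v unit_vec 1 i = unit_vec n z" if "z < n" for z
      using that \<open>i < 1\<close> by (intro eq_vecI) (auto simp: vertex_mat_def unit_vec_def scalar_prod_def)
    have "U * vertex_mat x *\<^sub>v unit_vec 1 i = U *\<^sub>v (vertex_mat x *\<^sub>v unit_vec 1 i)"
      using D by (intro mult_vec_assoc_dim[symmetric]) (auto simp: vertex_mat_def)
    also have "\<dots> = unit_vec n y"
      unfolding v[OF x] using U(3)[of None] by (simp add: F_def I_def)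
    finally show "U * vertex_mat x *\<^sub>v unit_vec 1 i = vertex_mat y *\<^sub>v unit_vec 1 i"
      unfolding v[OF y] .
  qed (use D in \<open>auto simp: vertex_mat_def\<close>)
  hence 0: "U * dual_idem n E x 0 = dual_idem n E y 0 * U"
    unfolding dual_idem_0[OF x] dual_idem_0[OF y]
    by (intro unitary_intertwines_projections[OF U(1), of _ 1]) (auto simp: vertex_mat_def)
  \<comment> \<open>Column by column this is the matching of the vectors \<open>Some i\<close>:
    \<open>U\<close> carries the neighbourhood space of \<open>x\<close> to that of
    \<open>y\<close>.\<close>
  have UC: "U * C x = C y * W"
  proof (rule mat_eq_unit_vecI)
    fix i assume "i < k"
    hence "U *\<^sub>v (C x *\<^sub>v unit_vec k i) = C y *\<^sub>v (W *\<^sub>v unit_vec k i)"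
      using U(3)[of "Some i"] by (simp add: F_def I_def)
    thus "U * C x *\<^sub>v unit_vec k i = C y * W *\<^sub>v unit_vec k i"
      using D DW by (simp add: mult_vec_assoc_dim del: assoc_mult_mat_vec)
  qed (use D DW in auto)
  \<comment> \<open>The factor \<open>W\<close> acts unitarily within the neighbourhood space and so
    leaves its projection unchanged.\<close>
  have "(C y * W) * mat_adjoint (C y * W) = C y * ((W * mat_adjoint W) * mat_adjoint (C y))"
    using DW(2,3) by (simp add: mat_adjoint_mult mult_assoc_dim)
  hence "(C y * W) * mat_adjoint (C y * W) = C y * mat_adjoint (C y)"
    using DW(5) left_mult_one_mat[of "mat_adjoint (C y)" k n] by simp
  hence 1: "U * dual_idem n E x 1 = dual_idem n E y 1 * U"
    unfolding dual_idem_1[OF x] dual_idem_1[OF y]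
    using unitary_intertwines_projections[OF U(1) C_carrier UC] by simp
  have 2: "U * dual_idem n E x 2 = dual_idem n E y 2 * U"
  proof -
    have "U * (1\<^sub>m n - (X + X')) = U - (U * X + U * X')" "(1\<^sub>m n - (X + X')) * U = U - (X * U + X' * U)"
      if "X \<in> carrier_mat n n" "X' \<in> carrier_mat n n" for X X'
      using D(1) that mult_minus_distrib_mat[of U n n "1\<^sub>m n" n "X + X'"] mult_add_distrib_mat[of U n n X n X']
        minus_mult_distrib_mat[of "1\<^sub>m n" n n "X + X'" U n] add_mult_distrib_mat[of X n n X' U n]
      by simp_all
    thus ?thesis unfolding dual_idem_2[OF x] dual_idem_2[OF y] using 0 1 by (metis dual_idem_carrier)
  qed
  have "U * dual_idem n E x i = dual_idem n E y i * U" for i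
  proof -
    consider "i = 0" | "i = 1" | "i = 2" | "i \<ge> 3" by linarith
    thus ?thesis
    proof cases
      case 4
      thus ?thesis using dual_idem_ge_3 x y D(1) by simp
    qed (use 0 1 2 in auto)
  qed
  thus ?thesis using that U(1,2) by blast
qed

section \<open>The two implications\<close>

text \<open>At distance 1, \<open>P\<close> intertwines the projections onto the neighbourhood
  spaces, so the compressions of \<open>A\<close> to them, the local adjacency matrices, have equal
  characteristic polynomials.\<close>

lemma pseudo_vertex_transitive_imp_spectrum:
  assumes pvt: "pseudo_vertex_transitive n E" and x: "x < n" and y: "y < n"
  shows "spectrum_mat (local_adj_mat n E x) = spectrum_mat (local_adj_mat n E y)"
proof (cases "x = y")
  case False
  obtain P where P: "P \<in> carrier_mat n n" "invertible_mat P" "P * A = A * P"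
    "\<And>i. i \<le> diameter n E \<Longrightarrow> P * dual_idem n E x i = dual_idem n E y i * P"
    using pvt x y unfolding pseudo_vertex_transitive_def A_def by blast
  obtain Q where Q: "P * Q = 1\<^sub>m n" "Q * P = 1\<^sub>m (dim_row Q)"
    using P(1,2) by (auto simp: invertible_mat_def inverts_mat_def)
  \<comment> \<open>The size of \<open>Q\<close> is recovered by comparing column counts in the two
    product equations.\<close>
  have Qc: "Q \<in> carrier_mat n n"
    using arg_cong[OF Q(1), of dim_col] arg_cong[OF Q(2), of dim_col] P(1) by auto
  have "P * (C x * mat_adjoint (C x)) = (C y * mat_adjoint (C y)) * P"
    using P(4)[OF diameter_ge_1[OF x y False]] dual_idem_1[OF x] dual_idem_1[OF y] by simp
  hence "char_poly (local_adj_mat n E x) = char_poly (local_adj_mat n E y)"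
    unfolding local_compression[OF x] local_compression[OF y]
    by (rule compression_char_poly_eq[OF A_carrier P(1) Qc Q(1) P(3) C_carrier C_orthonormal[OF x]
          C_carrier C_orthonormal[OF y]])
  thus ?thesis by (simp add: spectrum_mat_def)
qed simp

lemma pseudo_vertex_transitiveI:
  assumes "\<And>x y. x < n \<Longrightarrow> y < n \<Longrightarrow> \<exists>U. unitary_mat n U \<and> U * A = A * U \<and>
      (\<forall>i. U * dual_idem n E x i = dual_idem n E y i * U)"
  shows "pseudo_vertex_transitive n E"
  unfolding pseudo_vertex_transitive_def
proof (intro allI impI)
  fix x y assume "x < n" "y < n"
  then obtain U where U: "unitary_mat n U" "U * A = A * U"
    "\<And>i. U * dual_idem n E x i = dual_idem n E y i * U"
    using assms by blast
  note D = unitary_matD[OF U(1)]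
  define f where "f M = U * M * mat_adjoint U" for M
  define G where "G z = insert A {dual_idem n E z i | i. i \<le> diameter n E}" for z
  have f: "f M = N" if "U * M = N * U" "N \<in> carrier_mat n n" for M N
  proof -
    have "f M = N * (U * mat_adjoint U)" using that D by (simp add: f_def mult_assoc_dim)
    thus ?thesis using that D by simp
  qed
  have fA: "f A = A" and fd: "f (dual_idem n E x i) = dual_idem n E y i" for i
    using f U by simp_all
  \<comment> \<open>Generators go to generators, so the algebra generated by the image is the
    Terwilliger algebra at \<open>y\<close>.\<close>
  have "f ` G x = G y" unfolding G_def using fA fd by (auto simp: image_iff) metis
  moreover have "alg_iso (gen_alg (G x)) (gen_alg (f ` G x)) f"
    unfolding f_def by (rule alg_iso_conjugate) (use D in \<open>auto simp: G_def\<close>)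
  ultimately have "alg_iso (terwilliger n E x) (terwilliger n E y) f"
    by (simp add: terwilliger_def G_def A_def)
  moreover have "invertible_mat U"
    unfolding invertible_mat_def inverts_mat_def using D by (auto intro!: exI[of _ "mat_adjoint U"])
  ultimately show "(\<exists>f. alg_iso (terwilliger n E x) (terwilliger n E y) f \<and>
             f (adj_mat n E) = adj_mat n E \<and>
             (\<forall>i\<le>diameter n E. f (dual_idem n E x i) = dual_idem n E y i)) \<and>
        (\<exists>P \<in> carrier_mat n n. invertible_mat P \<and>
             P * adj_mat n E = adj_mat n E * P \<and>
             (\<forall>i\<le>diameter n E. P * dual_idem n E x i = dual_idem n E y i * P))"
    using fA fd U(2,3) D(1) unfolding A_def by blast
qed

lemma spectrum_imp_pseudo_vertex_transitive:
  assumes "c \<le> k"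
    and spec: "\<And>x y. x < n \<Longrightarrow> y < n \<Longrightarrow>
      spectrum_mat (local_adj_mat n E x) = spectrum_mat (local_adj_mat n E y)"
  shows "pseudo_vertex_transitive n E"
proof (rule pseudo_vertex_transitiveI)
  fix x y assume xy: "x < n" "y < n"
  show "\<exists>U. unitary_mat n U \<and> U * A = A * U \<and> (\<forall>i. U * dual_idem n E x i = dual_idem n E y i * U)"
  \<comment> \<open>The identity serves equal vertices. Distinct ones guarantee an edge, from which
    \<open>r \<noteq> s\<close> was derived.\<close>
  proof (cases "x = y")
    case True
    have "1\<^sub>m n * M = M * 1\<^sub>m n" if "M \<in> carrier_mat n n" for M :: "complex mat"
      using that by simp
    thus ?thesis using True unitary_mat_one by (metis A_carrier dual_idem_carrier)
  next
    case False
    thus ?thesis using unitary_intertwiner[OF xy False assms(1) spec[OF xy]] by metis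
  qed
qed

end

text \<open>The parameter \<open>c\<close> is arbitrary when the graph is complete; \<open>c = 0\<close> is then admissible.\<close>

lemma strongly_regular_c_le_k:
  assumes "strongly_regular n E k a c"
  obtains c' where "strongly_regular n E k a c'" "c' \<le> k"
proof (cases "\<exists>x<n. \<exists>y<n. x \<noteq> y \<and> \<not> E x y")
  case True
  then obtain x y where xy: "x < n" "y < n" "x \<noteq> y" "\<not> E x y" by blast
  have "card {z. z < n \<and> E x z \<and> E y z} \<le> card {z. z < n \<and> E x z}"
    by (rule card_mono) auto
  hence "c \<le> k" using assms xy by (auto simp: strongly_regular_def common_nbrs_def)
  thus ?thesis using that assms by blast
next
  case False
  hence "strongly_regular n E k a 0" using assms by (auto simp: strongly_regular_def)
  thus ?thesis using that by blast
qed

theorem theorem5p11: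
  fixes n :: nat and E :: "nat \<Rightarrow> nat \<Rightarrow> bool" and k a c :: nat
  assumes "strongly_regular n E k a c"
    and "connected_graph n E"
  shows "pseudo_vertex_transitive n E \<longleftrightarrow>
         (\<forall>x<n. \<forall>y<n. spectrum_mat (local_adj_mat n E x) = spectrum_mat (local_adj_mat n E y))"
proof -
  \<comment> \<open>The equivalence does not mention \<open>c\<close>, so a value bounded by
    \<open>k\<close> may replace it.\<close>
  obtain c' where c': "strongly_regular n E k a c'" "c' \<le> k"
    using strongly_regular_c_le_k[OF assms(1)] .
  interpret connected_srg n E k a c' using c'(1) assms(2) by unfold_locales
  show ?thesis
    using pseudo_vertex_transitive_imp_spectrum spectrum_imp_pseudo_vertex_transitive[OF c'(2)] by blast
qed

end
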